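(* Let $\mathcal S^{\mathrm{gr}} := W_0+\max\{V_1+2V_2,\; V_2+2V_3,\; V_3+2V_1\}$, where $W_0,V_1,V_2,V_3$ are jointly normal with $W_0$ independent of $(V_1,V_2,V_3)$, $W_0\sim N(0,2)$, and $$(V_1,V_2,V_3)\sim N\left(0,\begin{pmatrix} \frac23&-\frac13&-\frac13\\ -\frac13&\frac23&-\frac13\\ -\frac13&-\frac13&\frac23\end{pmatrix}\right).$$ Then the distribution of $\mathcal S^{\mathrm{gr}}$ can be described by any of the following equivalent formulas ($\overset{\mathrm d}{=}$ denotes equality in distribution): (i) $\mathcal S^{\mathrm{gr}} \overset{\mathrm d}{=} W+\max\{Z_1,Z_2,Z_3\}$, where $W,Z_1,Z_2,Z_3$ are jointly normal with $W$ independent of $(Z_1,Z_2,Z_3)$, $W\sim N(0,2)$, and $$(Z_1,Z_2,Z_3)\sim N\left(0,\begin{pmatrix}2&-1&-1\\-1&2&-1\\-1&-1&2\end{pmatrix}\right).$$ (ii) $\mathcal S^{\mathrm{gr}} \overset{\mathrm d}{=} W'+\sqrt3\,\max\{Z_1',Z_2',Z_3'\}$, where $W',Z_1',Z_2',Z_3'$ are independent standard normal $N(0,1)$. (iii) $\mathcal S^{\mathrm{gr}} \overset{\mathrm d}{=} \max\{Z_1'',Z_2'',Z_3''\}$, where $Z_1'',Z_2'',Z_3''$ are jointly normal with $$(Z_1'',Z_2'',Z_3'')\sim N\left(0,\begin{pmatrix}4&1&1\\1&4&1\\1&1&4\end{pmatrix}\right).$$ (iv) $\mathcal S^{\mathrm{gr}}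 \overset{\mathrm d}{=} W+R\cos\Theta$, where $W,R,\Theta$ are independent, $W\sim N(0,2)$, $R$ has a Rayleigh distribution with density $\frac12 r e^{-r^2/4}$, $r>0$, and $\Theta$ has the uniform distribution $U(0,\pi/3)$.
   Context: $N(0,\Sigma)$ denotes the (possibly degenerate) normal distribution with mean $0$ and variance, or covariance matrix, $\Sigma$. (The variable $\mathcal S^{\mathrm{gr}}$ arises as the limit in distribution of the normalized score $n^{-1/2}S_n$ in semi-restricted Rock, Paper, Scissors when both players play greedily; this fact is not needed to understand the statement.) *)

theory Defs
  imports "HOL-Probability.Probability"
begin

text \<open>The normal distribution on the real line, parametrised by mean and \<^emph>\<open>variance\<close>
  (unlike \<^const>\<open>normal_density\<close>, which takes the standard deviation); variance \<open>0\<close> gives the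
  point mass.\<close>

definition normal_measure :: "real \<Rightarrow> real \<Rightarrow> real measure" where
  "normal_measure m v =
     (if v = 0 then return borel m else density lborel (normal_density m (sqrt v)))"

text \<open>A random vector is jointly normal if every linear combination of its coordinates is
  normal, possibly degenerate.  For a pair \<open>(W, Z)\<close> of a real variable and a vector in
  \<open>real ^ 'n\<close>, the coordinates are \<open>W\<close> and all the \<open>Z $ i\<close>.\<close>

definition jointly_normal :: "'a measure \<Rightarrow> ('a \<Rightarrow> 'b::euclidean_space) \<Rightarrow> bool" where
  "jointly_normal M X \<longleftrightarrow>
     X \<in> borel_measurable M \<and>
     (\<forall>t. \<exists>m v. v \<ge> 0 \<and> distr M borel (\<lambda>\<omega>. t \<bullet> X \<omega>) = normal_measure m v)"

text \<open>\<open>X \<sim> N(m, \<Sigma>)\<close>.  Joint normality makes all coordinates square integrable, so the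
  integrals below are genuine expectations.\<close>

definition mv_normal :: "'a measure \<Rightarrow> ('a \<Rightarrow> real ^ 'n) \<Rightarrow> real ^ 'n \<Rightarrow> real ^ 'n ^ 'n \<Rightarrow> bool" where
  "mv_normal M X m \<Sigma> \<longleftrightarrow>
     jointly_normal M X \<and>
     (\<forall>i. (LINT \<omega>|M. X \<omega> $ i) = m $ i) \<and>
     (\<forall>i j. (LINT \<omega>|M. (X \<omega> $ i - m $ i) * (X \<omega> $ j - m $ j)) = \<Sigma> $ i $ j)"

text \<open>Independence of two random variables with values in different types;
  \<^const>\<open>prob_space.indep_var\<close> requires both to have the same type.\<close>

definition (in prob_space) indep_rvs ::
    "'b measure \<Rightarrow> ('a \<Rightarrow> 'b) \<Rightarrow> 'c measure \<Rightarrow> ('a \<Rightarrow> 'c) \<Rightarrow> bool" where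
  "indep_rvs S X T Y \<longleftrightarrow>
     random_variable S X \<and> random_variable T Y \<and>
     indep_set {X -` A \<inter> space M | A. A \<in> sets S} {Y -` A \<inter> space M | A. A \<in> sets T}"

end

theory Submission
  imports Defs
begin

text \<open>
  The score and its first three descriptions are maxima of the three coordinates of a centred
  Gaussian vector in \<open>real ^ 3\<close>. Put \<open>U = (V1 + 2 V2, V2 + 2 V3, V3 + 2 V1)\<close>; this is a linear image of \<open>V\<close> whose
  covariance matrix has \<open>2\<close> on the diagonal and \<open>-1\<close> elsewhere, like the vector \<open>Z\<close> of the first description. Adding an
  independent common summand of variance \<open>v\<close> to all coordinates adds \<open>v\<close> to every entry of the
  covariance matrix and adds that summand to the maximum. So the score is the maximum of a
  vector with covariances \<open>4\<close> and \<open>1\<close>, and so are the variables in these three descriptions.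
  A centred Gaussian vector is determined in law by its covariance matrix
  (\<open>gaussian_vector_distr_eq\<close>), which settles the three cases. Joint normality is given
  through one-dimensional projections only, so this rests on the Cramer-Wold device
  (\<open>cramer_wold\<close>): a probability law on a Euclidean space is determined by its projections.

  For the polar description it remains to see that \<open>max {U1, U2, U3}\<close> has the law of \<open>R cos \<Theta>\<close>. The vector
  \<open>U\<close> lives in a plane: in law it is the triple of inner products of \<open>(x, y)\<close>, with independent
  \<open>x, y \<sim> N(0,2)\<close>, and the three unit vectors at mutual angles \<open>2\<pi>/3\<close>. By exchangeability one may
  assume that the first coordinate \<open>x\<close> is the largest, at the price of a factor \<open>3\<close>. That happens
  exactly when the polar angle of \<open>(x, y)\<close> is in \<open>(-\<pi>/3, \<pi>/3)\<close>, and there the maximum is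
  \<open>x = r cos \<theta>\<close>. By reflection one may restrict \<open>\<theta>\<close> to \<open>(0, \<pi>/3)\<close>; polar coordinates in this
  sector (\<open>nn_integral_polar_sector\<close>) give the Rayleigh density for \<open>r\<close> and the uniform density
  for \<open>\<theta>\<close>. Finally, the law of a sum of two independent variables depends only on their laws.
\<close>

section \<open>The Cramer-Wold device\<close>

text \<open>
  Normalising the weights to total mass one turns both sides into characteristic functions of
  probability laws on the line, to which Levy's uniqueness theorem applies. Weights are what
  makes an induction over the coordinates possible: the indicators of the coordinates that have
  been dealt with go into the weight.
\<close>

lemma weighted_char_uniqueness:
  fixes X :: "'a \<Rightarrow> real" and Y :: "'b \<Rightarrow> real" and f :: "'a \<Rightarrow> real" and g :: "'b \<Rightarrow> real"
  assumes X [measurable]: "X \<in> borel_measurable M" and Y [measurable]: "Y \<in> borel_measurable N"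
    and f: "integrable M f" "\<And>\<omega>. 0 \<le> f \<omega>" and g: "integrable N g" "\<And>\<omega>. 0 \<le> g \<omega>"
    and eq: "\<And>s. (CLINT \<omega>|M. f \<omega> *\<^sub>R iexp (s * X \<omega>)) = (CLINT \<omega>|N. g \<omega> *\<^sub>R iexp (s * Y \<omega>))"
    and A [measurable]: "A \<in> sets borel"
  shows "(LINT \<omega>|M. indicator A (X \<omega>) * f \<omega>) = (LINT \<omega>|N. indicator A (Y \<omega>) * g \<omega>)"
proof -
  have [measurable]: "f \<in> borel_measurable M" "g \<in> borel_measurable N"
    using f g by auto
  define c where "c = (LINT \<omega>|M. f \<omega>)"
  have mass: "(LINT \<omega>|N. g \<omega>) = c"
  proof -
    have "complex_of_real c = complex_of_real (LINT \<omega>|N. g \<omega>)"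
      using eq[of 0] by (simp add: c_def scaleR_conv_of_real)
    then show ?thesis by (simp only: of_real_eq_iff)
  qed
  have "c \<ge> 0"
    unfolding c_def using f(2) by (simp add: integral_nonneg_AE)
  show ?thesis
  proof (cases "c = 0")
    case True
    have "AE \<omega> in M. f \<omega> = 0"
      using True integral_nonneg_eq_0_iff_AE[OF f(1)] f(2) by (simp add: c_def)
    then have 1: "(LINT \<omega>|M. indicator A (X \<omega>) * f \<omega>) = 0"
      by (intro integral_eq_zero_AE) auto
    have "AE \<omega> in N. g \<omega> = 0"
      using True mass integral_nonneg_eq_0_iff_AE[OF g(1)] g(2) by simp
    then have "(LINT \<omega>|N. indicator A (Y \<omega>) * g \<omega>) = 0"
      by (intro integral_eq_zero_AE) auto
    with 1 show ?thesis by simp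
  next
    case False
    with \<open>c \<ge> 0\<close> have c: "c > 0" by simp
    \<comment> \<open>The law of the variable under the normalised weight, once for both sides.\<close>
    have law: "real_distribution (distr (density K (\<lambda>\<omega>. ennreal (h \<omega> / c))) borel Z) \<and>
          (\<forall>s. char (distr (density K (\<lambda>\<omega>. ennreal (h \<omega> / c))) borel Z) s =
             (CLINT \<omega>|K. h \<omega> *\<^sub>R iexp (s * Z \<omega>)) / c) \<and>
          measure (distr (density K (\<lambda>\<omega>. ennreal (h \<omega> / c))) borel Z) A =
             (LINT \<omega>|K. indicator A (Z \<omega>) * h \<omega>) / c"
      if h: "integrable K h" "\<And>\<omega>. 0 \<le> h \<omega>" "(LINT \<omega>|K. h \<omega>) = c"
        and Z [measurable]: "Z \<in> borel_measurable K"
      for K :: "'k measure" and h Z :: "'k \<Rightarrow> real"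
    proof (intro conjI allI)
      have hm [measurable]: "h \<in> borel_measurable K" using h by auto
      let ?D = "density K (\<lambda>\<omega>. ennreal (h \<omega> / c))"
      have D: "prob_space ?D"
      proof
        have "(\<integral>\<^sup>+\<omega>. ennreal (h \<omega> / c) \<partial>K) = ennreal (LINT \<omega>|K. h \<omega> / c)"
          using h c by (intro nn_integral_eq_integral) auto
        also have "\<dots> = 1" using h c by simp
        finally show "emeasure ?D (space ?D) = 1" by (simp add: emeasure_density cong: nn_integral_cong)
      qed
      interpret prob_space ?D by fact
      show "real_distribution (distr ?D borel Z)"
        by (rule real_distribution_distr) simp
      show "char (distr ?D borel Z) s = (CLINT \<omega>|K. h \<omega> *\<^sub>R iexp (s * Z \<omega>)) / c" for s
        using c h unfolding char_def
        by (simp add: integral_distr integral_density scaleR_conv_of_real flip: integral_divide_zero)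
      have "measure (distr ?D borel Z) A = (LINT \<omega>|distr ?D borel Z. indicator A \<omega>)"
        by simp
      also have "\<dots> = (LINT \<omega>|K. (h \<omega> / c) *\<^sub>R indicator A (Z \<omega>))"
        using c h by (subst integral_distr) (simp_all add: integral_density)
      finally show "measure (distr ?D borel Z) A = (LINT \<omega>|K. indicator A (Z \<omega>) * h \<omega>) / c"
        by (simp add: mult.commute)
    qed
    note lM = law[OF f c_def[symmetric] X] and lN = law[OF g mass Y]
    have "distr (density M (\<lambda>\<omega>. ennreal (f \<omega> / c))) borel X =
          distr (density N (\<lambda>\<omega>. ennreal (g \<omega> / c))) borel Y"
      using lM lN eq by (intro Levy_uniqueness) auto
    then have "(LINT \<omega>|M. indicator A (X \<omega>) * f \<omega>) / c = (LINT \<omega>|N. indicator A (Y \<omega>) * g \<omega>) / c"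
      using lM lN by metis
    with c show ?thesis by simp
  qed
qed

lemma integrable_weight_iexp:
  fixes P :: "'e::euclidean_space measure"
  assumes "prob_space P" and [measurable_cong]: "sets P = sets borel"
    and [measurable]: "f \<in> borel_measurable borel" and "\<And>x. \<bar>f x\<bar> \<le> 1"
  shows "integrable P (\<lambda>x. f x *\<^sub>R iexp (t \<bullet> x))"
proof -
  interpret prob_space P by fact
  show ?thesis
    using assms(4) by (intro integrable_const_bound[where B=1]) auto
qed

text \<open>
  The weight \<open>1 + cos\<close> is nonnegative, as \<open>weighted_char_uniqueness\<close> requires, and it is a
  combination of exponentials. Multiplying by it therefore only shifts the argument of the
  Fourier transform \<open>J\<close> of \<open>f\<close>.
\<close>

lemma weighted_char_cos:
  fixes P :: "'e::euclidean_space measure" and f :: "'e \<Rightarrow> real" and a s :: real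
  assumes "prob_space P" "sets P = sets borel" "f \<in> borel_measurable borel" "\<And>x. \<bar>f x\<bar> \<le> 1"
  defines "J \<equiv> \<lambda>u. CLINT x|P. f x *\<^sub>R iexp (u \<bullet> x)"
  shows "(CLINT x|P. (f x * (1 + cos (t \<bullet> x + a))) *\<^sub>R iexp (s * (b \<bullet> x))) =
     J (s *\<^sub>R b) + (iexp a * J (s *\<^sub>R b + t) + iexp (- a) * J (s *\<^sub>R b - t)) / 2"
proof -
  have "(f x * (1 + cos (t \<bullet> x + a))) *\<^sub>R iexp (s * (b \<bullet> x)) =
      f x *\<^sub>R iexp ((s *\<^sub>R b) \<bullet> x) + (iexp a * (f x *\<^sub>R iexp ((s *\<^sub>R b + t) \<bullet> x)) +
        iexp (- a) * (f x *\<^sub>R iexp ((s *\<^sub>R b - t) \<bullet> x))) / 2" for x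
  proof -
    let ?u = "t \<bullet> x" and ?v = "s * (b \<bullet> x)"
    have "complex_of_real (cos r) = (iexp r + iexp (- r)) / 2" for r
      by (simp add: complex_eq_iff Re_exp Im_exp)
    from this[of "?u + a"]
    have "complex_of_real (cos (?u + a)) = (iexp (?u + a) + iexp (- (?u + a))) / 2" .
    moreover have "(s *\<^sub>R b) \<bullet> x = ?v" "(s *\<^sub>R b + t) \<bullet> x = ?v + ?u" "(s *\<^sub>R b - t) \<bullet> x = ?v - ?u"
      by (simp_all add: inner_simps)
    ultimately show ?thesis
      by (simp add: scaleR_conv_of_real algebra_simps exp_add exp_diff exp_minus add_divide_distrib) 
  qed
  then show ?thesis
    unfolding J_def
    by (simp only: Bochner_Integration.integral_add Bochner_Integration.integrable_add
        integral_divide_zero integral_mult_right_zero integrable_mult_right integrable_divide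
        integrable_weight_iexp[OF assms(1-4)])
qed

text \<open>
  The converse direction: the phases \<open>a = 0\<close> and \<open>a = - pi / 2\<close> give the cosine and the sine,
  each shifted by the total mass of \<open>f\<close>, which is half of the value at \<open>t = 0\<close>.
\<close>

lemma char_of_cos_weights:
  fixes P :: "'e::euclidean_space measure" and f :: "'e \<Rightarrow> real"
  assumes "prob_space P" and [measurable_cong]: "sets P = sets borel"
    and [measurable]: "f \<in> borel_measurable borel" and f: "\<And>x. \<bar>f x\<bar> \<le> 1"
  defines "C \<equiv> \<lambda>t a. LINT x|P. f x * (1 + cos (t \<bullet> x + a))"
  shows "(CLINT x|P. f x *\<^sub>R iexp (t \<bullet> x)) =
     of_real (C t 0 - C 0 0 / 2) + \<i> * of_real (C t (- (pi / 2)) - C 0 0 / 2)"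
proof -
  interpret prob_space P by fact
  have f_int: "integrable P f"
    using f by (intro integrable_const_bound[where B=1]) auto
  have f_cos: "integrable P (\<lambda>x. f x * cos (t \<bullet> x + a))" for t a
  proof (intro integrable_const_bound[where B=1] always_eventually allI)
    show "norm (f x * cos (t \<bullet> x + a)) \<le> 1" for x
      using mult_mono[OF f[of x] abs_cos_le_one[of "t \<bullet> x + a"]] by (simp add: abs_mult)
  qed measurable
  have C: "C t a = (LINT x|P. f x) + (LINT x|P. f x * cos (t \<bullet> x + a))" for t a
    unfolding C_def using f_int f_cos by (simp add: distrib_left)
  have "(CLINT x|P. f x *\<^sub>R iexp (t \<bullet> x)) =
     (CLINT x|P. complex_of_real (f x * cos (t \<bullet> x + 0)) +
        \<i> * complex_of_real (f x * cos (t \<bullet> x + - (pi / 2))))"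
    by (intro Bochner_Integration.integral_cong)
       (auto simp: cis_conv_exp[symmetric] complex_eq_iff cos_diff)
  also have "\<dots> = of_real (LINT x|P. f x * cos (t \<bullet> x + 0)) +
      \<i> * of_real (LINT x|P. f x * cos (t \<bullet> x + - (pi / 2)))"
    using f_cos[of t 0] f_cos[of t "-(pi/2)"]
    by (subst Bochner_Integration.integral_add) (auto simp del: of_real_mult)
  also have "\<dots> = of_real (C t 0 - C 0 0 / 2) + \<i> * of_real (C t (- (pi / 2)) - C 0 0 / 2)"
    by (simp add: C)
  finally show ?thesis .
qed

text \<open>
  Replace the exponential, one coordinate at a time, by the indicator of a Borel set of
  values of that coordinate. In each step the remaining exponential is split into the two
  nonnegative weights of \<open>weighted_char_cos\<close>, and the one-dimensional uniqueness theorem turns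
  equality of Fourier transforms in direction \<open>b\<close> into equality on sets. At the end the measures
  agree on all products of Borel sets.
\<close>

lemma char_uniqueness_euclidean:
  fixes P Q :: "'e::euclidean_space measure"
  assumes P: "prob_space P" "sets P = sets borel" and Q: "prob_space Q" "sets Q = sets borel"
    and char_eq: "\<And>t. (CLINT x|P. iexp (t \<bullet> x)) = (CLINT x|Q. iexp (t \<bullet> x))"
  shows "P = Q"
proof -
  note [measurable_cong] = P(2) Q(2)
  interpret P: prob_space P by fact
  interpret Q: prob_space Q by fact
  \<comment> \<open>The indicator of the coordinates in \<open>D\<close> having values in the sets \<open>A b\<close>.\<close>
  define I :: "'e set \<Rightarrow> ('e \<Rightarrow> real set) \<Rightarrow> 'e \<Rightarrow> real"
    where "I D A x = (\<Prod>b\<in>D. indicator (A b) (b \<bullet> x))" for D A x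
  have I_meas [measurable]: "I D A \<in> borel_measurable borel" if "\<And>b. A b \<in> sets borel" for D A
    unfolding I_def using that by measurable
  have I_bound: "\<bar>I D A x\<bar> \<le> 1" "0 \<le> I D A x" for D A x
    unfolding I_def by (auto simp: abs_prod indicator_def intro!: prod_le_1 prod_nonneg)
  have int: "integrable K (\<lambda>x. I D A x * (1 + cos (t \<bullet> x + a)))"
    if "prob_space K" and [measurable_cong]: "sets K = sets borel"
      and "\<And>b. A b \<in> sets borel" for K D A t a
  proof -
    interpret K: prob_space K by fact
    note [measurable] = I_meas[OF that(3)]
    show ?thesis
    proof (intro K.integrable_const_bound[where B=2] always_eventually allI)
      show "norm (I D A x * (1 + cos (t \<bullet> x + a))) \<le> 2" for x
      proof -
        have "\<bar>1 + cos (t \<bullet> x + a)\<bar> \<le> 2"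
          using abs_cos_le_one[of "t \<bullet> x + a"] by linarith
        then show ?thesis
          using mult_mono[OF I_bound(1)[of D A x]] by (fastforce simp: abs_mult)
      qed
    qed measurable
  qed
  have J_eq: "(CLINT x|P. I D A x *\<^sub>R iexp (t \<bullet> x)) = (CLINT x|Q. I D A x *\<^sub>R iexp (t \<bullet> x))"
    if "finite D" "\<And>b. A b \<in> sets borel" for D t A
    using that(1)
  proof (induction D arbitrary: t rule: finite_induct)
    case empty
    then show ?case using char_eq by (simp add: I_def)
  next
    case (insert b D)
    note w = weighted_char_cos[where f = "I D A", OF _ _ I_meas[OF that(2)] I_bound(1)]
    have "(LINT x|P. I (insert b D) A x * (1 + cos (t \<bullet> x + a))) =
          (LINT x|Q. I (insert b D) A x * (1 + cos (t \<bullet> x + a)))" for t a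
    proof -
      have "(LINT x|P. indicator (A b) (b \<bullet> x) * (I D A x * (1 + cos (t \<bullet> x + a)))) =
            (LINT x|Q. indicator (A b) (b \<bullet> x) * (I D A x * (1 + cos (t \<bullet> x + a))))"
      proof (rule weighted_char_uniqueness)
        show "integrable P (\<lambda>x. I D A x * (1 + cos (t \<bullet> x + a)))"
             "integrable Q (\<lambda>x. I D A x * (1 + cos (t \<bullet> x + a)))"
          using P Q that(2) by (auto intro: int)
        show "0 \<le> I D A x * (1 + cos (t \<bullet> x + a))"
             "0 \<le> I D A x * (1 + cos (t \<bullet> x + a))" for x
          using I_bound(2)[of D A x] cos_ge_minus_one[of "t \<bullet> x + a"]
          by (simp_all add: mult_nonneg_nonneg del: cos_ge_minus_one)
        show "A b \<in> sets borel" by fact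
        show "(CLINT x|P. (I D A x * (1 + cos (t \<bullet> x + a))) *\<^sub>R iexp (s * (b \<bullet> x))) =
              (CLINT x|Q. (I D A x * (1 + cos (t \<bullet> x + a))) *\<^sub>R iexp (s * (b \<bullet> x)))" for s
          by (simp only: w[OF P] w[OF Q] insert.IH)
      qed measurable
      moreover have "I (insert b D) A x = indicator (A b) (b \<bullet> x) * I D A x" for x
        using insert.hyps by (simp add: I_def)
      ultimately show ?thesis by (simp add: mult.assoc)
    qed
    note this
      char_of_cos_weights[where f = "I (insert b D) A", OF _ _ I_meas[OF that(2)] I_bound(1)]
    then show ?case
      by (simp only: P Q)
  qed
  show ?thesis
  proof (rule measure_eqI_generator_eq[where \<Omega>=UNIV and A="\<lambda>_. UNIV"
        and E="{{x. \<forall>b\<in>Basis. x \<bullet> b \<in> A b} | A. \<forall>b. A b \<in> sets borel}"])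
    let ?E = "{{x::'e. \<forall>b\<in>Basis. x \<bullet> b \<in> A b} | A. \<forall>b. A b \<in> sets (borel::real measure)}"
    show "Int_stable ?E"
    proof (rule Int_stableI)
      fix S T assume "S \<in> ?E" "T \<in> ?E"
      then obtain A B where "S = {x. \<forall>b\<in>Basis. x \<bullet> b \<in> A b}" "\<forall>b. A b \<in> sets borel"
        "T = {x. \<forall>b\<in>Basis. x \<bullet> b \<in> B b}" "\<forall>b. B b \<in> sets borel" by auto
      then show "S \<inter> T \<in> ?E"
        by (intro CollectI exI[of _ "\<lambda>b. A b \<inter> B b"]) auto
    qed
    have E_sets: "?E \<subseteq> sets borel"
    proof safe
      fix A :: "'e \<Rightarrow> real set" assume "\<forall>b. A b \<in> sets borel"
      then have [measurable]: "\<And>b. A b \<in> sets borel" by auto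
      show "{x. \<forall>b\<in>Basis. x \<bullet> b \<in> A b} \<in> sets borel" by measurable
    qed
    have "sets (borel :: 'e measure) = sigma_sets UNIV ?E"
    proof
      have "range (\<lambda>(a, b). box a b :: 'e set) \<subseteq> ?E"
      proof safe
        fix l u :: 'e
        have "box l u = {x. \<forall>b\<in>Basis. x \<bullet> b \<in> {l \<bullet> b<..<u \<bullet> b}}" by (auto simp: box_def)
        then show "\<exists>A. box l u = {x. \<forall>b\<in>Basis. x \<bullet> b \<in> A b} \<and> (\<forall>b. A b \<in> sets borel)"
          by (intro exI[of _ "\<lambda>b. {l \<bullet> b<..<u \<bullet> b}"]) simp
      qed
      then show "sets (borel :: 'e measure) \<subseteq> sigma_sets UNIV ?E"
        by (subst borel_eq_box) (simp add: sigma_sets_mono')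
      show "sigma_sets UNIV ?E \<subseteq> sets borel"
        using E_sets sets.sigma_sets_subset[of ?E borel] by simp
    qed
    then show "sets P = sigma_sets UNIV ?E" "sets Q = sigma_sets UNIV ?E"
      using P Q by auto
    show "range (\<lambda>_. UNIV) \<subseteq> ?E"
      by (auto intro!: exI[of _ "\<lambda>_. UNIV"])
    show "emeasure P UNIV \<noteq> \<infinity>" by simp
    fix S assume "S \<in> ?E"
    then obtain A where A: "S = {x. \<forall>b\<in>Basis. x \<bullet> b \<in> A b}" "\<And>b. A b \<in> sets borel"
      by auto
    have [measurable]: "S \<in> sets borel" using \<open>S \<in> ?E\<close> E_sets by blast
    have I_S: "I Basis A x = indicator S x" for x
      unfolding I_def A by (auto simp: indicator_def inner_commute)
    have "complex_of_real (measure K S) = (CLINT x|K. I Basis A x *\<^sub>R iexp (0 \<bullet> x))"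
      if [measurable_cong]: "sets K = sets borel" for K
      using sets_eq_imp_space_eq[OF that] by (simp add: I_S scaleR_conv_of_real)
    from this[OF P(2)] this[OF Q(2)] J_eq[of Basis A 0] A(2)
    have "complex_of_real (measure P S) = complex_of_real (measure Q S)" by simp
    then show "emeasure P S = emeasure Q S"
      by (simp add: P.emeasure_eq_measure Q.emeasure_eq_measure)
  qed auto
qed

text \<open>
  The characteristic function of \<open>X\<close> at \<open>t\<close> is that of the projection \<open>t \<bullet> X\<close> at \<open>1\<close>.
\<close>

theorem cramer_wold:
  fixes X :: "'a \<Rightarrow> 'e::euclidean_space" and Y :: "'b \<Rightarrow> 'e"
  assumes "prob_space M" "prob_space N"
    and [measurable]: "X \<in> borel_measurable M" "Y \<in> borel_measurable N"
    and proj: "\<And>t. distr M borel (\<lambda>\<omega>. t \<bullet> X \<omega>) = distr N borel (\<lambda>\<omega>. t \<bullet> Y \<omega>)"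
  shows "distr M borel X = distr N borel Y"
proof (rule char_uniqueness_euclidean)
  fix t :: 'e
  have "(CLINT x|distr M borel X. iexp (t \<bullet> x)) = char (distr M borel (\<lambda>\<omega>. t \<bullet> X \<omega>)) 1"
    by (simp add: char_def integral_distr)
  also have "\<dots> = (CLINT x|distr N borel Y. iexp (t \<bullet> x))"
    unfolding proj by (simp add: char_def integral_distr)
  finally show "(CLINT x|distr M borel X. iexp (t \<bullet> x)) = (CLINT x|distr N borel Y. iexp (t \<bullet> x))" .
qed (use assms in \<open>auto intro: prob_space.prob_space_distr\<close>)

section \<open>Normal laws on the line and their projections\<close>

lemmas [measurable] = borel_measurable_nth

lemma prob_space_normal_measure: "0 \<le> v \<Longrightarrow> prob_space (normal_measure m v)"
  unfolding normal_measure_def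
  by (auto intro: prob_space_return prob_space_normal_density)

lemma sets_normal_measure [simp, measurable_cong]: "sets (normal_measure m v) = sets borel"
  unfolding normal_measure_def by simp

lemma real_distribution_normal_measure: "0 \<le> v \<Longrightarrow> real_distribution (normal_measure m v)"
  using prob_space_normal_measure[of v m]
  by (simp add: real_distribution_def real_distribution_axioms_def)

lemma distr_eq_normal_measure:
  assumes "distributed M lborel X (normal_density m (sqrt v))" "0 < v"
  shows "distr M borel X = normal_measure m v"
  using distributed_distr_eq_density[OF assms(1)] assms(2)
  by (simp add: normal_measure_def cong: distr_cong)

text \<open>
  Writing a normal law as an affine image of the standard one treats the degenerate case
  \<open>v = 0\<close> together with the others.
\<close>

lemma normal_measure_eq_distr:
  assumes "0 \<le> v"
  shows "normal_measure m v = distr std_normal_distribution borel (\<lambda>x. m + sqrt v * x)"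
proof (cases "v = 0")
  case True
  have "distr std_normal_distribution borel (\<lambda>x. m) = return borel m"
    using prob_space_normal_density[of 1 0] by (intro prob_space.distr_const) auto
  with True show ?thesis by (simp add: normal_measure_def)
next
  case False
  with assms have v: "v > 0" by simp
  interpret prob_space std_normal_distribution
    by (rule prob_space_normal_density) simp
  have "distributed std_normal_distribution lborel (\<lambda>x. x) std_normal_density"
    by (simp add: distributed_def)
       (simp add: distr_id2)
  from normal_density_affine[OF this, of "sqrt v" m] v
  show ?thesis
    by (intro distr_eq_normal_measure[symmetric]) simp_all
qed

lemma char_normal_measure:
  assumes "0 \<le> v"
  shows "char (normal_measure m v) t = iexp (t * m) * of_real (exp (- (v * t\<^sup>2) / 2))"
proof -
  have "char (normal_measure m v) t =
      (CLINT x|std_normal_distribution. iexp (t * m) * iexp ((t * sqrt v) * x))"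
    unfolding normal_measure_eq_distr[OF assms] char_def
    by (subst integral_distr) (simp_all add: algebra_simps exp_add)
  also have "\<dots> = iexp (t * m) * char std_normal_distribution (t * sqrt v)"
    by (simp add: char_def)
  also have "\<dots> = iexp (t * m) * of_real (exp (- (v * t\<^sup>2) / 2))"
    using assms by (simp add: char_std_normal_distribution power_mult_distrib mult.commute)
  finally show ?thesis .
qed

lemma normal_measure_moments:
  assumes [measurable]: "X \<in> borel_measurable M"
    and X: "distr M borel X = normal_measure m v" and v: "0 \<le> v"
  shows "integrable M X" "integrable M (\<lambda>\<omega>. (X \<omega>)\<^sup>2)"
    "(LINT \<omega>|M. X \<omega>) = m" "(LINT \<omega>|M. (X \<omega>)\<^sup>2) = v + m\<^sup>2"
proof -
  interpret prob_space std_normal_distribution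
    by (rule prob_space_normal_density) simp
  note X' = X[unfolded normal_measure_eq_distr[OF v]]
  have i1: "integrable std_normal_distribution (\<lambda>x. x)"
    using integrable_std_normal_distribution_moment[of 1] by simp
  have i2: "integrable std_normal_distribution (\<lambda>x. x\<^sup>2)"
    by (rule integrable_std_normal_distribution_moment)
  have e1: "expectation (\<lambda>x. x) = 0"
    using integral_std_normal_distribution_moment_odd[of 1] by simp
  have e2: "expectation (\<lambda>x. x\<^sup>2) = 1"
    using std_normal_distribution_even_moments(1)[of 1] by (simp add: fact_numeral)
  have sq: "(m + sqrt v * x)\<^sup>2 = m\<^sup>2 + 2 * m * sqrt v * x + v * x\<^sup>2" for x
    using v by (simp add: power2_sum power_mult_distrib)
  have aff: "(\<lambda>x. m + sqrt v * x) \<in> borel_measurable std_normal_distribution"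
    by simp
  have j1: "integrable std_normal_distribution (\<lambda>x. m + sqrt v * x)"
    using i1 by (intro Bochner_Integration.integrable_add integrable_const integrable_mult_right)
  have j2: "integrable std_normal_distribution (\<lambda>x. (m + sqrt v * x)\<^sup>2)"
    unfolding sq using i1 i2
    by (intro Bochner_Integration.integrable_add integrable_const integrable_mult_right)
  have f1: "expectation (\<lambda>x. m + sqrt v * x) = m"
    using i1 e1 prob_space by simp
  have f2: "expectation (\<lambda>x. (m + sqrt v * x)\<^sup>2) = v + m\<^sup>2"
    unfolding sq using i1 i2 e1 e2 prob_space by simp
  have transfer: "integrable M (\<lambda>\<omega>. h (X \<omega>)) \<longleftrightarrow>
        integrable std_normal_distribution (\<lambda>x. h (m + sqrt v * x))"
      "(LINT \<omega>|M. h (X \<omega>)) = expectation (\<lambda>x. h (m + sqrt v * x))"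
    if [measurable]: "h \<in> borel_measurable borel" for h :: "real \<Rightarrow> real"
  proof -
    have "integrable M (\<lambda>\<omega>. h (X \<omega>)) \<longleftrightarrow> integrable (distr M borel X) h"
      by (rule integrable_distr_eq[symmetric]) measurable
    also have "\<dots> \<longleftrightarrow> integrable std_normal_distribution (\<lambda>x. h (m + sqrt v * x))"
      unfolding X' by (rule integrable_distr_eq[OF aff that])
    finally show "integrable M (\<lambda>\<omega>. h (X \<omega>)) \<longleftrightarrow>
        integrable std_normal_distribution (\<lambda>x. h (m + sqrt v * x))" .
    have "(LINT \<omega>|M. h (X \<omega>)) = (LINT x|distr M borel X. h x)"
      by (rule integral_distr[symmetric]) measurable
    also have "\<dots> = expectation (\<lambda>x. h (m + sqrt v * x))"
      unfolding X' by (rule integral_distr[OF aff that])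
    finally show "(LINT \<omega>|M. h (X \<omega>)) = expectation (\<lambda>x. h (m + sqrt v * x))" .
  qed
  have id: "(\<lambda>x::real. x) \<in> borel_measurable borel"
    and sqm: "(\<lambda>x::real. x\<^sup>2) \<in> borel_measurable borel" by measurable
  show "integrable M X" "(LINT \<omega>|M. X \<omega>) = m"
    using transfer[OF id] j1 f1 by simp_all
  show "integrable M (\<lambda>\<omega>. (X \<omega>)\<^sup>2)" "(LINT \<omega>|M. (X \<omega>)\<^sup>2) = v + m\<^sup>2"
    using transfer[OF sqm] j2 f2 by simp_all
qed

lemma distr_cmult_normal:
  assumes [measurable]: "X \<in> borel_measurable M"
    and X: "distr M borel X = normal_measure m v" and v: "0 \<le> v"
  shows "distr M borel (\<lambda>\<omega>. c * X \<omega>) = normal_measure (c * m) (c\<^sup>2 * v)"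
proof -
  have "distr M borel (\<lambda>\<omega>. c * X \<omega>) = distr (normal_measure m v) borel (\<lambda>x. c * x)"
    unfolding X[symmetric] by (subst distr_distr) (simp_all add: comp_def)
  also have "\<dots> = normal_measure (c * m) (c\<^sup>2 * v)"
  proof (rule Levy_uniqueness)
    have "prob_space (normal_measure m v)" using v by (rule prob_space_normal_measure)
    then show "real_distribution (distr (normal_measure m v) borel (\<lambda>x. c * x))"
      by (rule prob_space.real_distribution_distr) measurable
    show "real_distribution (normal_measure (c * m) (c\<^sup>2 * v))"
      by (rule real_distribution_normal_measure) (simp add: v)
    show "char (distr (normal_measure m v) borel (\<lambda>x. c * x)) = char (normal_measure (c * m) (c\<^sup>2 * v))"
    proof
      fix t
      have "char (distr (normal_measure m v) borel (\<lambda>x. c * x)) t = char (normal_measure m v) (t * c)"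
        unfolding char_def by (subst integral_distr) (simp_all add: mult.assoc)
      also have "\<dots> = iexp (t * c * m) * of_real (exp (- (v * (t * c)\<^sup>2) / 2))"
        by (rule char_normal_measure[OF v])
      also have "\<dots> = iexp (t * (c * m)) * of_real (exp (- (c\<^sup>2 * v * t\<^sup>2) / 2))"
        by (simp only: power_mult_distrib mult.assoc mult.commute mult.left_commute)
      also have "\<dots> = char (normal_measure (c * m) (c\<^sup>2 * v)) t"
        by (rule char_normal_measure[symmetric]) (simp add: v)
      finally show "char (distr (normal_measure m v) borel (\<lambda>x. c * x)) t =
        char (normal_measure (c * m) (c\<^sup>2 * v)) t" .
    qed
  qed
  finally show ?thesis .
qed

text \<open>
  The characteristic function of an independent sum is a product of characteristic functions.
\<close>

lemma (in prob_space) distr_add_indep_cong: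
  assumes "prob_space N" "indep_var borel X borel Y" "prob_space.indep_var N borel X' borel Y'"
    and "distr M borel X = distr N borel X'" "distr M borel Y = distr N borel Y'"
  shows "distr M borel (\<lambda>\<omega>. X \<omega> + Y \<omega> :: real) = distr N borel (\<lambda>\<omega>. X' \<omega> + Y' \<omega>)"
proof (rule Levy_uniqueness)
  interpret N: prob_space N by fact
  note [measurable] = indep_var_rv1[OF assms(2)] indep_var_rv2[OF assms(2)]
    N.indep_var_rv1[OF assms(3)] N.indep_var_rv2[OF assms(3)]
  show "real_distribution (distr M borel (\<lambda>\<omega>. X \<omega> + Y \<omega>))"
    by (rule real_distribution_distr) simp
  show "real_distribution (distr N borel (\<lambda>\<omega>. X' \<omega> + Y' \<omega>))"
    by (rule N.real_distribution_distr) simp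
  show "char (distr M borel (\<lambda>\<omega>. X \<omega> + Y \<omega>)) = char (distr N borel (\<lambda>\<omega>. X' \<omega> + Y' \<omega>))"
    using assms by (simp add: fun_eq_iff char_distr_add N.char_distr_add)
qed

lemma (in prob_space) distr_add_indep_normal:
  assumes ind: "indep_var borel X borel Y"
    and X: "distr M borel X = normal_measure m v" "0 \<le> v"
    and Y: "distr M borel Y = normal_measure m' v'" "0 \<le> v'"
  shows "distr M borel (\<lambda>\<omega>. X \<omega> + Y \<omega>) = normal_measure (m + m') (v + v')"
proof (rule Levy_uniqueness)
  note [measurable] = indep_var_rv1[OF ind] indep_var_rv2[OF ind]
  show "real_distribution (distr M borel (\<lambda>\<omega>. X \<omega> + Y \<omega>))"
    by (rule real_distribution_distr) simp
  show "real_distribution (normal_measure (m + m') (v + v'))"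
    using assms by (intro real_distribution_normal_measure) simp
  show "char (distr M borel (\<lambda>\<omega>. X \<omega> + Y \<omega>)) = char (normal_measure (m + m') (v + v'))"
  proof
    fix t
    have "exp (- ((v + v') * t\<^sup>2) / 2) = exp (- (v * t\<^sup>2) / 2) * exp (- (v' * t\<^sup>2) / 2)"
      by (simp add: exp_add[symmetric] field_simps)
    moreover have "iexp (t * (m + m')) = iexp (t * m) * iexp (t * m')"
      by (simp add: exp_add[symmetric] distrib_left)
    ultimately show "char (distr M borel (\<lambda>\<omega>. X \<omega> + Y \<omega>)) t = char (normal_measure (m + m') (v + v')) t"
      using X Y by (simp only: char_distr_add[OF ind] char_normal_measure add_nonneg_nonneg
          of_real_mult mult.assoc mult.commute mult.left_commute)
  qed
qed

lemma (in prob_space) distr_sum_indep_normal: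
  assumes ind: "indep_vars (\<lambda>_. borel) X I"
    and X: "\<And>i. i \<in> I \<Longrightarrow> distr M borel (X i) = normal_measure (m i) (v i)"
    and v: "\<And>i. i \<in> I \<Longrightarrow> 0 \<le> v i"
  shows "distr M borel (\<lambda>\<omega>. \<Sum>i\<in>I. X i \<omega>) = normal_measure (\<Sum>i\<in>I. m i) (\<Sum>i\<in>I. v i)"
  using assms
proof (induction I rule: infinite_finite_induct)
  case (insert i I)
  have "indep_var borel (X i) borel (\<lambda>\<omega>. \<Sum>j\<in>I. X j \<omega>)"
    using insert by (intro indep_vars_sum) auto
  moreover have "distr M borel (\<lambda>\<omega>. \<Sum>j\<in>I. X j \<omega>) = normal_measure (\<Sum>j\<in>I. m j) (\<Sum>j\<in>I. v j)"
    using insert.prems by (intro insert.IH) (auto intro: indep_vars_subset)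
  moreover have "0 \<le> (\<Sum>j\<in>I. v j)"
    using insert.prems by (intro sum_nonneg) auto
  ultimately have "distr M borel (\<lambda>\<omega>. X i \<omega> + (\<Sum>j\<in>I. X j \<omega>)) =
      normal_measure (m i + (\<Sum>j\<in>I. m j)) (v i + (\<Sum>j\<in>I. v j))"
    using insert.prems by (intro distr_add_indep_normal) auto
  then show ?case
    using insert.hyps by simp
qed (simp_all add: normal_measure_def distr_const)

text \<open>
  Normality of \<open>t \<bullet> X\<close> is the definition of joint normality, so only its mean and variance
  have to be found. They are bilinear in \<open>t\<close>; the products of coordinates are integrable because
  each coordinate is normal and hence square integrable.
\<close>

lemma mv_normal_inner:
  fixes X :: "'a \<Rightarrow> real ^ 'n"
  assumes "prob_space M" and X: "mv_normal M X m \<Sigma>"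
  shows "distr M borel (\<lambda>\<omega>. t \<bullet> X \<omega>) = normal_measure (t \<bullet> m) (t \<bullet> (\<Sigma> *v t))"
    and "0 \<le> t \<bullet> (\<Sigma> *v t)"
proof -
  interpret prob_space M by fact
  have normal: "\<And>t. \<exists>m v. v \<ge> 0 \<and> distr M borel (\<lambda>\<omega>. t \<bullet> X \<omega>) = normal_measure m v"
    and [measurable]: "X \<in> borel_measurable M"
    and mean: "\<And>i. expectation (\<lambda>\<omega>. X \<omega> $ i) = m $ i"
    and cov: "\<And>i j. expectation (\<lambda>\<omega>. (X \<omega> $ i - m $ i) * (X \<omega> $ j - m $ j)) = \<Sigma> $ i $ j"
    using X unfolding mv_normal_def jointly_normal_def by auto
  have comp: "integrable M (\<lambda>\<omega>. X \<omega> $ i) \<and> integrable M (\<lambda>\<omega>. (X \<omega> $ i)\<^sup>2)" for i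
  proof -
    have coord: "axis i 1 \<bullet> x = x $ i" for x :: "real ^ 'n"
      by (simp add: cart_eq_inner_axis inner_commute)
    obtain a b where b: "b \<ge> 0" and "distr M borel (\<lambda>\<omega>. axis i 1 \<bullet> X \<omega>) = normal_measure a b"
      using normal by blast
    then have law: "distr M borel (\<lambda>\<omega>. X \<omega> $ i) = normal_measure a b"
      by (simp only: coord)
    have "(\<lambda>\<omega>. X \<omega> $ i) \<in> borel_measurable M"
      by measurable
    from normal_measure_moments(1,2)[OF this law b] show ?thesis by blast
  qed
  \<comment> \<open>Centred coordinates; \<open>2 * \<bar>u * v\<bar> \<le> u\<^sup>2 + v\<^sup>2\<close> makes their products integrable.\<close>
  define Y where "Y i \<omega> = X \<omega> $ i - m $ i" for i \<omega>
  have [measurable]: "Y i \<in> borel_measurable M" for i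
    unfolding Y_def by measurable
  have sqY: "integrable M (\<lambda>\<omega>. (Y i \<omega>)\<^sup>2)" for i
    using comp[of i] unfolding Y_def by (simp add: power2_diff)
  have prodY: "integrable M (\<lambda>\<omega>. Y i \<omega> * Y j \<omega>)" for i j
  proof (rule Bochner_Integration.integrable_bound)
    show "integrable M (\<lambda>\<omega>. (Y i \<omega>)\<^sup>2 + (Y j \<omega>)\<^sup>2)"
      using sqY by simp
    show "AE \<omega> in M. norm (Y i \<omega> * Y j \<omega>) \<le> norm ((Y i \<omega>)\<^sup>2 + (Y j \<omega>)\<^sup>2)"
    proof (intro always_eventually allI)
      fix \<omega>
      have "2 * \<bar>Y i \<omega>\<bar> * \<bar>Y j \<omega>\<bar> \<le> (Y i \<omega>)\<^sup>2 + (Y j \<omega>)\<^sup>2"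
        using sum_squares_bound[of "\<bar>Y i \<omega>\<bar>" "\<bar>Y j \<omega>\<bar>"] by simp
      moreover have "0 \<le> \<bar>Y i \<omega>\<bar> * \<bar>Y j \<omega>\<bar>" by simp
      ultimately show "norm (Y i \<omega> * Y j \<omega>) \<le> norm ((Y i \<omega>)\<^sup>2 + (Y j \<omega>)\<^sup>2)"
        by (simp only: real_norm_def abs_mult)
    qed
  qed measurable
  obtain a v where v: "v \<ge> 0" and law: "distr M borel (\<lambda>\<omega>. t \<bullet> X \<omega>) = normal_measure a v"
    using normal by blast
  note mom = normal_measure_moments[OF _ law v, simplified]
  have "a = expectation (\<lambda>\<omega>. \<Sum>i\<in>UNIV. t $ i * X \<omega> $ i)"
    using mom(3) by (simp add: inner_vec_def)
  also have "\<dots> = t \<bullet> m"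
    using comp by (simp add: mean inner_vec_def)
  finally have a: "a = t \<bullet> m" .
  have "v = expectation (\<lambda>\<omega>. (t \<bullet> X \<omega> - a)\<^sup>2)"
    using mom by (simp add: power2_diff prob_space) (simp add: power2_eq_square)
  also have "\<dots> = expectation (\<lambda>\<omega>. \<Sum>i\<in>UNIV. \<Sum>j\<in>UNIV. t $ i * t $ j * (Y i \<omega> * Y j \<omega>))"
  proof (intro Bochner_Integration.integral_cong refl)
    fix \<omega>
    have "t \<bullet> X \<omega> - a = (\<Sum>i\<in>UNIV. t $ i * Y i \<omega>)"
      by (simp add: a Y_def inner_vec_def right_diff_distrib sum_subtractf)
    then show "(t \<bullet> X \<omega> - a)\<^sup>2 = (\<Sum>i\<in>UNIV. \<Sum>j\<in>UNIV. t $ i * t $ j * (Y i \<omega> * Y j \<omega>))"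
      by (simp add: power2_eq_square sum_product ac_simps)
  qed
  also have "\<dots> = (\<Sum>i\<in>UNIV. \<Sum>j\<in>UNIV. t $ i * t $ j * \<Sigma> $ i $ j)"
    using prodY by (simp add: cov[folded Y_def])
  also have "\<dots> = t \<bullet> (\<Sigma> *v t)"
    by (simp add: inner_vec_def matrix_vector_mult_def sum_distrib_left ac_simps)
  finally have "v = t \<bullet> (\<Sigma> *v t)" .
  with law a v show "distr M borel (\<lambda>\<omega>. t \<bullet> X \<omega>) = normal_measure (t \<bullet> m) (t \<bullet> (\<Sigma> *v t))"
    "0 \<le> t \<bullet> (\<Sigma> *v t)" by simp_all
qed

lemma (in prob_space) indep_rvs_compose:
  assumes "indep_rvs S X T Y" and [measurable]: "f \<in> measurable S S'" "g \<in> measurable T T'"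
  shows "indep_rvs S' (\<lambda>\<omega>. f (X \<omega>)) T' (\<lambda>\<omega>. g (Y \<omega>))"
proof -
  have [measurable]: "random_variable S X" "random_variable T Y"
    and ind: "indep_set {X -` A \<inter> space M | A. A \<in> sets S} {Y -` A \<inter> space M | A. A \<in> sets T}"
    using assms(1) unfolding indep_rvs_def by auto
  have sub: "{(\<lambda>\<omega>. h (Z \<omega>)) -` A \<inter> space M | A. A \<in> sets U'} \<subseteq> {Z -` A \<inter> space M | A. A \<in> sets U}"
    if h: "h \<in> measurable U U'" and Z: "Z \<in> measurable M U"
    for h :: "'u \<Rightarrow> 'v" and Z :: "'a \<Rightarrow> 'u" and U U'
  proof safe
    fix A assume "A \<in> sets U'"
    then have "h -` A \<inter> space U \<in> sets U" using h by (rule measurable_sets[rotated])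
    moreover have "(\<lambda>\<omega>. h (Z \<omega>)) -` A \<inter> space M = Z -` (h -` A \<inter> space U) \<inter> space M"
      using measurable_space[OF Z] by auto
    ultimately show "\<exists>B. (\<lambda>\<omega>. h (Z \<omega>)) -` A \<inter> space M = Z -` B \<inter> space M \<and> B \<in> sets U"
      by blast
  qed
  have "indep_set {(\<lambda>\<omega>. f (X \<omega>)) -` A \<inter> space M | A. A \<in> sets S'}
      {(\<lambda>\<omega>. g (Y \<omega>)) -` A \<inter> space M | A. A \<in> sets T'}"
    using ind sub[OF assms(2) \<open>X \<in> measurable M S\<close>] sub[OF assms(3) \<open>Y \<in> measurable M T\<close>]
    unfolding indep_sets2_eq by (meson subset_iff subset_trans)
  then show ?thesis
    unfolding indep_rvs_def by (intro conjI) measurable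
qed

lemma (in prob_space) indep_rvs_imp_indep_var:
  assumes "indep_rvs S X T Y"
  shows "indep_var S X T Y"
proof -
  have stable: "Int_stable {Z -` A \<inter> space M | A. A \<in> sets U}" for Z :: "'a \<Rightarrow> 'u" and U
  proof (safe intro!: Int_stableI)
    fix A B assume "A \<in> sets U" "B \<in> sets U"
    then show "\<exists>C. (Z -` A \<inter> space M) \<inter> (Z -` B \<inter> space M) = Z -` C \<inter> space M \<and> C \<in> sets U"
      by (intro exI[of _ "A \<inter> B"]) auto
  qed
  show ?thesis
    using assms unfolding indep_rvs_def indep_var_eq
    by (blast intro: indep_set_sigma_sets stable)
qed

section \<open>Centred Gaussian vectors\<close>

lemma borel_measurable_vec_lambda:
  fixes f :: "'n::finite \<Rightarrow> 'a \<Rightarrow> real"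
  assumes "\<And>i. f i \<in> borel_measurable M"
  shows "(\<lambda>\<omega>. \<chi> i. f i \<omega>) \<in> borel_measurable M"
proof (subst borel_measurable_euclidean_space, intro ballI)
  fix e :: "real ^ 'n" assume "e \<in> Basis"
  then obtain i where "e = axis i 1" by (auto simp: Basis_vec_def)
  then have "(\<lambda>\<omega>. (\<chi> i. f i \<omega>) \<bullet> e) = f i"
    by (simp add: inner_axis)
  then show "(\<lambda>\<omega>. (\<chi> i. f i \<omega>) \<bullet> e) \<in> borel_measurable M"
    using assms by simp
qed

text \<open>
  Centred joint normality with covariance matrix \<open>\<Sigma>\<close>, phrased through the laws of the
  projections. This is the form that passes through linear maps and independent sums without
  computing any integral. The condition on the quadratic form keeps
  \<^const>\<open>normal_measure\<close> away from negative variances.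
\<close>

definition gaussian_vector :: "'a measure \<Rightarrow> ('a \<Rightarrow> real ^ 'n) \<Rightarrow> real ^ 'n ^ 'n \<Rightarrow> bool" where
  "gaussian_vector M X \<Sigma> \<longleftrightarrow> X \<in> borel_measurable M \<and>
     (\<forall>t. 0 \<le> t \<bullet> (\<Sigma> *v t) \<and>
          distr M borel (\<lambda>\<omega>. t \<bullet> X \<omega>) = normal_measure 0 (t \<bullet> (\<Sigma> *v t)))"

lemma gaussian_vectorD:
  assumes "gaussian_vector M X \<Sigma>"
  shows "X \<in> borel_measurable M" "0 \<le> t \<bullet> (\<Sigma> *v t)"
    "distr M borel (\<lambda>\<omega>. t \<bullet> X \<omega>) = normal_measure 0 (t \<bullet> (\<Sigma> *v t))"
  using assms[unfolded gaussian_vector_def] by (blast, blast, blast)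

lemma mv_normal_imp_gaussian_vector:
  assumes "prob_space M" "mv_normal M X 0 \<Sigma>"
  shows "gaussian_vector M X \<Sigma>"
proof -
  have "X \<in> borel_measurable M"
    using assms(2) unfolding mv_normal_def jointly_normal_def by blast
  then show ?thesis
    unfolding gaussian_vector_def using mv_normal_inner[OF assms] by (simp only: inner_zero_right simp_thms)
qed

lemma gaussian_vector_distr_eq:
  assumes "prob_space M" "prob_space N" "gaussian_vector M X \<Sigma>" "gaussian_vector N Y \<Sigma>"
  shows "distr M borel X = distr N borel Y"
  by (rule cramer_wold[OF assms(1,2) gaussian_vectorD(1)[OF assms(3)] gaussian_vectorD(1)[OF assms(4)]])
     (simp only: gaussian_vectorD(3)[OF assms(3)] gaussian_vectorD(3)[OF assms(4)])

lemma gaussian_vector_linear_image: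
  assumes "gaussian_vector M X \<Sigma>"
  shows "gaussian_vector M (\<lambda>\<omega>. A *v X \<omega>) (A ** \<Sigma> ** transpose A)"
proof -
  note [measurable] = gaussian_vectorD(1)[OF assms]
  have "t \<bullet> (A *v x) = (transpose A *v t) \<bullet> x" for t x
    by (simp add: dot_lmul_matrix)
  moreover have "t \<bullet> ((A ** \<Sigma> ** transpose A) *v t) =
      (transpose A *v t) \<bullet> (\<Sigma> *v (transpose A *v t))" for t
    by (simp add: dot_lmul_matrix flip: matrix_vector_mul_assoc)
  moreover have "(\<lambda>\<omega>. A *v X \<omega>) \<in> borel_measurable M"
    by (rule measurable_compose[OF gaussian_vectorD(1)[OF assms]])
       (intro borel_measurable_continuous_onI matrix_vector_mult_linear_continuous_on)
  ultimately show ?thesis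
    using gaussian_vectorD(2,3)[OF assms] by (simp only: gaussian_vector_def simp_thms)
qed

text \<open>
  The covariance matrices that occur are all of this exchangeable form.
\<close>

definition equicov :: "real \<Rightarrow> real \<Rightarrow> real ^ 'n ^ 'n" where
  "equicov a b = (\<chi> i j. if i = j then a else b)"

lemma equicov_3:
  "equicov a b = (vector [vector [a, b, b], vector [b, a, b], vector [b, b, a]] :: real ^ 3 ^ 3)"
  by (simp add: equicov_def vec_eq_iff forall_3)

lemma inner_equicov:
  fixes t :: "real ^ 'n"
  shows "t \<bullet> (equicov a b *v t) = (a - b) * (\<Sum>i\<in>UNIV. (t $ i)\<^sup>2) + b * (\<Sum>i\<in>UNIV. t $ i)\<^sup>2"
proof -
  have comp: "(equicov a b *v t) $ i = (a - b) * t $ i + b * (\<Sum>j\<in>UNIV. t $ j)" for i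
  proof -
    have "(equicov a b *v t) $ i = (\<Sum>j\<in>UNIV. (if j = i then (a - b) * t $ i else 0) + b * t $ j)"
      unfolding equicov_def matrix_vector_mult_def
      by (auto intro!: sum.cong simp: algebra_simps)
    then show ?thesis by (simp add: sum.distrib sum_distrib_left)
  qed
  have "t \<bullet> (equicov a b *v t) = (\<Sum>i\<in>UNIV. (a - b) * (t $ i)\<^sup>2 + b * (t $ i * (\<Sum>j\<in>UNIV. t $ j)))"
    unfolding inner_vec_def comp by (simp add: power2_eq_square algebra_simps)
  also have "\<dots> = (a - b) * (\<Sum>i\<in>UNIV. (t $ i)\<^sup>2) + b * ((\<Sum>i\<in>UNIV. t $ i) * (\<Sum>j\<in>UNIV. t $ j))"
    by (simp only: sum.distrib sum_distrib_left[symmetric] sum_distrib_right[symmetric])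
  finally show ?thesis by (simp only: power2_eq_square)
qed

text \<open>
  Projecting to \<open>t\<close>, the common summand contributes \<open>(\<Sum>i. t $ i) * W\<close>, whose variance is the
  quadratic form of the matrix with all entries \<open>v\<close>.
\<close>

lemma (in prob_space) gaussian_vector_add_common:
  fixes X :: "'a \<Rightarrow> real ^ 'n"
  assumes X: "gaussian_vector M X (equicov a b)" and ind: "indep_rvs borel W borel X"
    and W: "distr M borel W = normal_measure 0 v" "0 \<le> v"
  shows "gaussian_vector M (\<lambda>\<omega>. \<chi> i. W \<omega> + X \<omega> $ i) (equicov (a + v) (b + v))"
proof -
  have [measurable]: "X \<in> borel_measurable M" "W \<in> borel_measurable M"
    using ind unfolding indep_rvs_def by auto
  have "0 \<le> t \<bullet> (equicov (a + v) (b + v) *v t) \<and>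
      distr M borel (\<lambda>\<omega>. t \<bullet> (\<chi> i. W \<omega> + X \<omega> $ i)) =
      normal_measure 0 (t \<bullet> (equicov (a + v) (b + v) *v t))" for t
  proof -
    let ?c = "\<Sum>i\<in>UNIV. t $ i"
    have var: "t \<bullet> (equicov (a + v) (b + v) *v t) = ?c\<^sup>2 * v + t \<bullet> (equicov a b *v t)"
      unfolding inner_equicov by (simp add: algebra_simps)
    have "distr M borel (\<lambda>\<omega>. ?c * W \<omega> + t \<bullet> X \<omega>) = normal_measure (?c * 0 + 0) (?c\<^sup>2 * v + t \<bullet> (equicov a b *v t))"
    proof (rule distr_add_indep_normal)
      show "indep_var borel (\<lambda>\<omega>. ?c * W \<omega>) borel (\<lambda>\<omega>. t \<bullet> X \<omega>)"
        by (intro indep_rvs_imp_indep_var indep_rvs_compose[OF ind]) measurable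
      show "distr M borel (\<lambda>\<omega>. ?c * W \<omega>) = normal_measure (?c * 0) (?c\<^sup>2 * v)"
        using W by (intro distr_cmult_normal) auto
    qed (use W gaussian_vectorD(2,3)[OF X] in auto)
    moreover have "t \<bullet> (\<chi> i. w + x $ i) = ?c * w + t \<bullet> x" for w and x :: "real ^ 'n"
      by (simp add: inner_vec_def distrib_left sum.distrib sum_distrib_right)
    ultimately show ?thesis
      using W(2) gaussian_vectorD(2)[OF X, of t] by (simp add: var)
  qed
  moreover have "(\<lambda>\<omega>. \<chi> i. W \<omega> + X \<omega> $ i) \<in> borel_measurable M"
    by (rule borel_measurable_vec_lambda) measurable
  ultimately show ?thesis
    unfolding gaussian_vector_def by blast
qed

definition max3 :: "real ^ 3 \<Rightarrow> real" where
  "max3 z = Max {z $ 1, z $ 2, z $ 3}"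

lemma max3_eq: "max3 z = max (z $ 1) (max (z $ 2) (z $ 3))"
  by (simp add: max3_def)

lemma borel_measurable_max3 [measurable]: "max3 \<in> borel_measurable borel"
  unfolding max3_eq[abs_def] by measurable

lemma max3_add: "max3 (\<chi> i. w + z $ i) = w + max3 z"
  by (simp add: max3_eq max_add_distrib_right)

lemma gaussian_vector_max3_eq:
  assumes "prob_space M" "prob_space N" "gaussian_vector M X \<Sigma>" "gaussian_vector N Y \<Sigma>"
  shows "distr M borel (\<lambda>\<omega>. max3 (X \<omega>)) = distr N borel (\<lambda>\<omega>. max3 (Y \<omega>))"
proof -
  have "distr (distr M borel X) borel max3 = distr (distr N borel Y) borel max3"
    using gaussian_vector_distr_eq[OF assms] by simp
  then show ?thesis
    using gaussian_vectorD(1)[OF assms(3)] gaussian_vectorD(1)[OF assms(4)]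
    by (simp add: distr_distr comp_def)
qed

text \<open>
  Each projection is a sum of four independent normal variables.
\<close>

lemma (in prob_space) gaussian_vector_indep_std:
  assumes ind: "indep_vars (\<lambda>_. borel) (\<lambda>i. [W, Z1, Z2, Z3] ! i) {..<4}"
    and dist: "distributed M lborel W std_normal_density"
      "distributed M lborel Z1 std_normal_density"
      "distributed M lborel Z2 std_normal_density"
      "distributed M lborel Z3 std_normal_density"
  shows "gaussian_vector M
    (\<lambda>\<omega>. vector [W \<omega> + sqrt 3 * Z1 \<omega>, W \<omega> + sqrt 3 * Z2 \<omega>, W \<omega> + sqrt 3 * Z3 \<omega>] :: real ^ 3) (equicov 4 1)"
    (is "gaussian_vector M ?X _")
proof -
  let ?f = "\<lambda>i. [W, Z1, Z2, Z3] ! i"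
  have rv: "random_variable borel (?f i)" if "i < 4" for i
    using ind that by (auto simp: indep_vars_def)
  from rv[of 0] rv[of 1] rv[of 2] rv[of 3]
  have [measurable]: "random_variable borel W" "random_variable borel Z1"
    "random_variable borel Z2" "random_variable borel Z3"
    by (simp_all add: numeral_2_eq_2 numeral_3_eq_3)
  have 4: "{..<4} = {0, 1, 2, 3::nat}" by auto
  have law: "distr M borel (?f i) = normal_measure 0 1" if "i < 4" for i
    using dist[THEN distr_eq_normal_measure[where v = 1, simplified]] that
    by (auto simp: less_Suc_eq numeral_eq_Suc)
  have "0 \<le> t \<bullet> (equicov 4 1 *v t) \<and>
      distr M borel (\<lambda>\<omega>. t \<bullet> ?X \<omega>) = normal_measure 0 (t \<bullet> (equicov 4 1 *v t))" for t :: "real ^ 3"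
  proof -
    define c where "c = [t $ 1 + t $ 2 + t $ 3, sqrt 3 * t $ 1, sqrt 3 * t $ 2, sqrt 3 * t $ 3]"
    have law_sum: "distr M borel (\<lambda>\<omega>. \<Sum>i<4. c ! i * ?f i \<omega>) =
        normal_measure (\<Sum>i<4. c ! i * 0) (\<Sum>i<4::nat. (c ! i)\<^sup>2 * 1)"
    proof (rule distr_sum_indep_normal)
      show "indep_vars (\<lambda>_. borel) (\<lambda>i \<omega>. c ! i * ?f i \<omega>) {..<4}"
        by (rule indep_vars_compose2[OF ind]) measurable
      show "distr M borel (\<lambda>\<omega>. c ! i * ?f i \<omega>) = normal_measure (c ! i * 0) ((c ! i)\<^sup>2 * 1)"
        if "i \<in> {..<4}" for i
        using that rv law by (intro distr_cmult_normal) auto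
    qed simp
    have comb: "(\<Sum>i<4. c ! i * ?f i \<omega>) = t \<bullet> ?X \<omega>" for \<omega>
      by (simp add: 4 c_def inner_vec_def sum_3 numeral_2_eq_2 numeral_3_eq_3 algebra_simps)
    have var: "(\<Sum>i<4::nat. (c ! i)\<^sup>2) = t \<bullet> (equicov 4 1 *v t)"
      unfolding inner_equicov
      by (simp add: 4 c_def sum_3 power_mult_distrib)
    have "0 \<le> (\<Sum>i<4::nat. (c ! i)\<^sup>2)" by (simp add: sum_nonneg)
    then show ?thesis
      using law_sum by (simp only: comb var mult_zero_right sum.neutral_const mult_1_right simp_thms)
  qed
  moreover have "?X \<in> borel_measurable M"
  proof -
    have "?X = (\<lambda>\<omega>. \<chi> i. W \<omega> + sqrt 3 * (if i = 1 then Z1 \<omega> else if i = 2 then Z2 \<omega> else Z3 \<omega>))"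
      by (simp add: fun_eq_iff vec_eq_iff forall_3)
    also have "\<dots> \<in> borel_measurable M"
      by (rule borel_measurable_vec_lambda) measurable
    finally show ?thesis .
  qed
  ultimately show ?thesis
    unfolding gaussian_vector_def by blast
qed

section \<open>Polar coordinates in a sector\<close>

lemma cos_pos_sector:
  assumes "\<theta> \<in> {0..pi/3}"
  shows "0 < cos \<theta>"
proof -
  have "- (pi / 2) < \<theta>" "\<theta> < pi / 2"
    using assms pi_gt_zero unfolding atLeastAtMost_iff by linarith+
  then show ?thesis by (rule cos_gt_zero_pi)
qed

text \<open>
  The segment \<open>{x} \<times> [0, sqrt 3 * x]\<close> is the part of a vertical line inside the sector
  of angles between \<open>0\<close> and \<open>pi / 3\<close>; \<open>y = x tan \<theta>\<close> parametrises it by the angle.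
\<close>

lemma nn_integral_tan_substitution:
  fixes f :: "real \<Rightarrow> ennreal"
  assumes [measurable]: "f \<in> borel_measurable borel" and x: "0 < x"
  shows "(\<integral>\<^sup>+y. f y * indicator {0..sqrt 3 * x} y \<partial>lborel) =
    (\<integral>\<^sup>+\<theta>. f (x * tan \<theta>) * ennreal (x / (cos \<theta>)\<^sup>2) * indicator {0..pi/3} \<theta> \<partial>lborel)"
proof -
  note cos = cos_pos_sector
  have "(\<integral>\<^sup>+y. f y * indicator {x * tan 0..x * tan (pi/3)} y \<partial>lborel) =
    (\<integral>\<^sup>+\<theta>. f (x * tan \<theta>) * ennreal (x / (cos \<theta>)\<^sup>2) * indicator {0..pi/3} \<theta> \<partial>lborel)"
  proof (rule nn_integral_substitution_aux)
    show "((\<lambda>\<theta>. x * tan \<theta>) has_real_derivative x / (cos \<theta>)\<^sup>2) (at \<theta>)" if "\<theta> \<in> {0..pi/3}" for \<theta>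
      using cos[OF that] by (auto intro!: derivative_eq_intros simp: field_simps)
    show "continuous_on {0..pi/3} (\<lambda>\<theta>. x / (cos \<theta>)\<^sup>2)"
      using cos by (intro continuous_intros) force
    show "0 \<le> x / (cos \<theta>)\<^sup>2" for \<theta> using x by simp
  qed (use pi_gt_zero in auto)
  then show ?thesis by (simp add: tan_60 mult.commute)
qed

text \<open>
  Polar coordinates by two one-dimensional substitutions: \<open>y = x tan \<theta>\<close> for fixed \<open>x\<close>, then,
  after exchanging the integrals, \<open>x = r cos \<theta>\<close> for fixed \<open>\<theta>\<close>. The Jacobians
  \<open>x / cos\<^sup>2 \<theta>\<close> and \<open>cos \<theta>\<close> multiply to \<open>r\<close>.
\<close>

lemma nn_integral_polar_sector:
  fixes F :: "real \<times> real \<Rightarrow> ennreal"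
  assumes [measurable]: "F \<in> borel_measurable borel"
  shows "(\<integral>\<^sup>+x. \<integral>\<^sup>+y. F (x, y) * indicator {0<..} x * indicator {0..sqrt 3 * x} y \<partial>lborel \<partial>lborel) =
    (\<integral>\<^sup>+\<theta>. \<integral>\<^sup>+r. F (r * cos \<theta>, r * sin \<theta>) * ennreal r * indicator {0<..} r *
       indicator {0..pi/3} \<theta> \<partial>lborel \<partial>lborel)"
proof -
  have [measurable]: "F \<in> borel_measurable (borel \<Otimes>\<^sub>M borel)"
    using assms by (simp add: borel_prod)
  define G where "G x \<theta> = F (x, x * (sin \<theta> / cos \<theta>)) * ennreal (x / (cos \<theta>)\<^sup>2) *
    indicator {0<..} x * indicator {0..pi/3} \<theta>" for x \<theta> :: real
  have [measurable]: "case_prod G \<in> borel_measurable (borel \<Otimes>\<^sub>M borel)"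
    unfolding G_def by measurable
  have "(\<integral>\<^sup>+y. F (x, y) * indicator {0<..} x * indicator {0..sqrt 3 * x} y \<partial>lborel) =
      (\<integral>\<^sup>+\<theta>. G x \<theta> \<partial>lborel)" for x
  proof (cases "0 < x")
    case True
    then show ?thesis
      using nn_integral_tan_substitution[of "\<lambda>y. F (x, y)" x]
      by (simp add: G_def tan_def)
  qed (simp add: G_def)
  then have "(\<integral>\<^sup>+x. \<integral>\<^sup>+y. F (x, y) * indicator {0<..} x * indicator {0..sqrt 3 * x} y \<partial>lborel \<partial>lborel) =
      (\<integral>\<^sup>+x. \<integral>\<^sup>+\<theta>. G x \<theta> \<partial>lborel \<partial>lborel)"
    by simp
  also have "\<dots> = (\<integral>\<^sup>+\<theta>. \<integral>\<^sup>+x. G x \<theta> \<partial>lborel \<partial>lborel)"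
    by (rule lborel_pair.Fubini'[symmetric]) simp
  also have "\<dots> = (\<integral>\<^sup>+\<theta>. \<integral>\<^sup>+r. F (r * cos \<theta>, r * sin \<theta>) * ennreal r * indicator {0<..} r *
       indicator {0..pi/3} \<theta> \<partial>lborel \<partial>lborel)"
  proof (rule nn_integral_cong)
    fix \<theta> :: real
    show "(\<integral>\<^sup>+x. G x \<theta> \<partial>lborel) = (\<integral>\<^sup>+r. F (r * cos \<theta>, r * sin \<theta>) * ennreal r *
       indicator {0<..} r * indicator {0..pi/3} \<theta> \<partial>lborel)"
    proof (cases "\<theta> \<in> {0..pi/3}")
      case True
      then have c: "cos \<theta> > 0" by (rule cos_pos_sector)
      have "(\<integral>\<^sup>+x. G x \<theta> \<partial>lborel) = ennreal (cos \<theta>) * (\<integral>\<^sup>+r. G (cos \<theta> * r) \<theta> \<partial>lborel)"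
        using nn_integral_real_affine[of "\<lambda>x. G x \<theta>" "cos \<theta>" 0] c by simp
      also have "\<dots> = (\<integral>\<^sup>+r. ennreal (cos \<theta>) * G (cos \<theta> * r) \<theta> \<partial>lborel)"
        by (rule nn_integral_cmult[symmetric]) simp
      also have "\<dots> = (\<integral>\<^sup>+r. F (r * cos \<theta>, r * sin \<theta>) * ennreal r * indicator {0<..} r *
          indicator {0..pi/3} \<theta> \<partial>lborel)"
      proof (intro nn_integral_cong)
        fix r :: real
        show "ennreal (cos \<theta>) * G (cos \<theta> * r) \<theta> = F (r * cos \<theta>, r * sin \<theta>) * ennreal r *
          indicator {0<..} r * indicator {0..pi/3} \<theta>"
        proof (cases "0 < r")
          case True
          have "ennreal (cos \<theta>) * ennreal (cos \<theta> * r / (cos \<theta>)\<^sup>2) = ennreal r"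
            using c True by (simp add: ennreal_mult[symmetric] power2_eq_square)
          moreover have "cos \<theta> * r * (sin \<theta> / cos \<theta>) = r * sin \<theta>"
            using c by simp
          moreover have "ennreal (cos \<theta>) * G (cos \<theta> * r) \<theta> =
              F (cos \<theta> * r, cos \<theta> * r * (sin \<theta> / cos \<theta>)) *
              (ennreal (cos \<theta>) * ennreal (cos \<theta> * r / (cos \<theta>)\<^sup>2)) *
              indicator {0<..} (cos \<theta> * r) * indicator {0..pi/3} \<theta>"
            by (simp only: G_def mult_ac)
          ultimately show ?thesis
            using c True by (simp add: mult.commute[of r])
        qed (use c in \<open>simp add: G_def zero_less_mult_iff\<close>)
      qed
      finally show ?thesis .
    qed (simp add: G_def)
  qed
  finally show ?thesis .
qed

lemma normal_density_sqrt_2: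
  "normal_density 0 (sqrt 2) x = 1 / (2 * sqrt pi) * exp (- x\<^sup>2 / 4)"
  by (simp add: normal_density_def real_sqrt_mult)

text \<open>
  On the left, \<open>(x, y)\<close> is in the sector of angles between \<open>- pi / 3\<close> and \<open>pi / 3\<close>. The
  reflection \<open>y \<mapsto> - y\<close> reduces it to half of that sector, where the rotational symmetry
  of the product density makes the integrand in polar coordinates a product.
\<close>

lemma nn_integral_normal_sector:
  fixes h :: "real \<Rightarrow> ennreal"
  assumes [measurable]: "h \<in> borel_measurable borel"
  shows "(\<integral>\<^sup>+x. \<integral>\<^sup>+y. h x * indicator {- sqrt 3 * x<..<sqrt 3 * x} y
        \<partial>normal_measure 0 2 \<partial>normal_measure 0 2) =
    (\<integral>\<^sup>+\<theta>. \<integral>\<^sup>+r. h (r * cos \<theta>) * ennreal (1 / (2 * pi) * r * exp (- r\<^sup>2 / 4)) *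
       indicator {0<..} r * indicator {0..pi/3} \<theta> \<partial>lborel \<partial>lborel)"
proof -
  define n where "n = (\<lambda>x. ennreal (normal_density 0 (sqrt 2) x))"
  have [measurable]: "n \<in> borel_measurable borel" unfolding n_def by simp
  have N: "normal_measure 0 2 = density lborel n"
    by (simp add: normal_measure_def n_def)
  have n_even: "n (- y) = n y" for y by (simp add: n_def normal_density_def)
  \<comment> \<open>The factor \<open>2\<close> accounts for the reflected half of the sector.\<close>
  define F where "F = (\<lambda>(x, y). 2 * h x * n x * n y)"
  have [measurable]: "F \<in> borel_measurable (borel \<Otimes>\<^sub>M borel)" unfolding F_def by measurable
  have inner: "n x * (\<integral>\<^sup>+y. n y * (h x * indicator {- sqrt 3 * x<..<sqrt 3 * x} y) \<partial>lborel) =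
      (\<integral>\<^sup>+y. F (x, y) * indicator {0<..} x * indicator {0..sqrt 3 * x} y \<partial>lborel)" for x
  proof (cases "0 < x")
    case True
    have "(\<integral>\<^sup>+y. n y * (h x * indicator {- sqrt 3 * x<..<sqrt 3 * x} y) \<partial>lborel) =
        (\<integral>\<^sup>+y. n y * h x * indicator {0..sqrt 3 * x} y +
          n y * h x * indicator {0..sqrt 3 * x} (- y) \<partial>lborel)"
    proof (rule nn_integral_cong_AE)
      \<comment> \<open>Outside these three points the open interval is the disjoint union of the closed half and its reflection.\<close>
      have "AE y in lborel. y \<noteq> 0 \<and> y \<noteq> sqrt 3 * x \<and> y \<noteq> - (sqrt 3 * x)"
        using AE_lborel_singleton[of 0] AE_lborel_singleton[of "sqrt 3 * x"]
          AE_lborel_singleton[of "- (sqrt 3 * x)"] by eventually_elim auto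
      then show "AE y in lborel. n y * (h x * indicator {- sqrt 3 * x<..<sqrt 3 * x} y) =
          n y * h x * indicator {0..sqrt 3 * x} y + n y * h x * indicator {0..sqrt 3 * x} (- y)"
      proof eventually_elim
        case (elim y)
        have pos: "0 < sqrt 3 * x" using True by simp
        show ?case
          using elim pos by (cases "0 < y"; auto simp: indicator_def)
      qed
    qed
    also have "\<dots> = (\<integral>\<^sup>+y. n y * h x * indicator {0..sqrt 3 * x} y \<partial>lborel) +
        (\<integral>\<^sup>+y. n y * h x * indicator {0..sqrt 3 * x} (- y) \<partial>lborel)"
      by (rule nn_integral_add) measurable
    also have "(\<integral>\<^sup>+y. n y * h x * indicator {0..sqrt 3 * x} (- y) \<partial>lborel) =
        (\<integral>\<^sup>+y. n y * h x * indicator {0..sqrt 3 * x} y \<partial>lborel)"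
      using nn_integral_real_affine[of "\<lambda>y. n y * h x * indicator {0..sqrt 3 * x} y" "-1" 0]
      by (simp add: n_even)
    finally have "n x * (\<integral>\<^sup>+y. n y * (h x * indicator {- sqrt 3 * x<..<sqrt 3 * x} y) \<partial>lborel) =
        n x * 2 * (\<integral>\<^sup>+y. n y * h x * indicator {0..sqrt 3 * x} y \<partial>lborel)"
      by (simp only: mult_2[symmetric] mult.assoc)
    also have "\<dots> = (\<integral>\<^sup>+y. n x * 2 * (n y * h x * indicator {0..sqrt 3 * x} y) \<partial>lborel)"
      by (rule nn_integral_cmult[symmetric]) measurable
    also have "\<dots> = (\<integral>\<^sup>+y. F (x, y) * indicator {0<..} x * indicator {0..sqrt 3 * x} y \<partial>lborel)"
      using True by (intro nn_integral_cong) (simp add: F_def mult_ac)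
    finally show ?thesis .
  next
    case False
    then have "{- sqrt 3 * x<..<sqrt 3 * x} = {}"
      by (auto simp: greaterThanLessThan_empty_iff mult_le_0_iff)
    with False show ?thesis by simp
  qed
  have "(\<integral>\<^sup>+x. \<integral>\<^sup>+y. h x * indicator {- sqrt 3 * x<..<sqrt 3 * x} y
        \<partial>normal_measure 0 2 \<partial>normal_measure 0 2) =
      (\<integral>\<^sup>+x. n x * (\<integral>\<^sup>+y. n y * (h x * indicator {- sqrt 3 * x<..<sqrt 3 * x} y) \<partial>lborel) \<partial>lborel)"
  proof -
    have [measurable]: "(\<lambda>x. \<integral>\<^sup>+y. n y * (h x * indicator {- sqrt 3 * x<..<sqrt 3 * x} y) \<partial>lborel)
        \<in> borel_measurable lborel"
      unfolding indicator_def[abs_def] greaterThanLessThan_iff by measurable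
    have "(\<integral>\<^sup>+y. h x * indicator {- sqrt 3 * x<..<sqrt 3 * x} y \<partial>density lborel n) =
        (\<integral>\<^sup>+y. n y * (h x * indicator {- sqrt 3 * x<..<sqrt 3 * x} y) \<partial>lborel)" for x
      by (rule nn_integral_density) measurable
    then show ?thesis
      unfolding N by (simp only:) (rule nn_integral_density; measurable)
  qed
  also have "\<dots> = (\<integral>\<^sup>+x. \<integral>\<^sup>+y. F (x, y) * indicator {0<..} x * indicator {0..sqrt 3 * x} y \<partial>lborel \<partial>lborel)"
    by (simp only: inner)
  also have "\<dots> = (\<integral>\<^sup>+\<theta>. \<integral>\<^sup>+r. F (r * cos \<theta>, r * sin \<theta>) * ennreal r * indicator {0<..} r *
       indicator {0..pi/3} \<theta> \<partial>lborel \<partial>lborel)"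
    by (rule nn_integral_polar_sector) (simp add: borel_prod[symmetric])
  also have "\<dots> = (\<integral>\<^sup>+\<theta>. \<integral>\<^sup>+r. h (r * cos \<theta>) * ennreal (1 / (2 * pi) * r * exp (- r\<^sup>2 / 4)) *
       indicator {0<..} r * indicator {0..pi/3} \<theta> \<partial>lborel \<partial>lborel)"
  proof (intro nn_integral_cong)
    fix \<theta> r :: real
    show "F (r * cos \<theta>, r * sin \<theta>) * ennreal r * indicator {0<..} r * indicator {0..pi/3} \<theta> =
        h (r * cos \<theta>) * ennreal (1 / (2 * pi) * r * exp (- r\<^sup>2 / 4)) *
        indicator {0<..} r * indicator {0..pi/3} \<theta>"
    proof (cases "0 < r")
      case True
      have sq: "(r * cos \<theta>)\<^sup>2 + (r * sin \<theta>)\<^sup>2 = r\<^sup>2"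
        by (simp add: power_mult_distrib flip: distrib_left)
      have "exp (- (r * cos \<theta>)\<^sup>2 / 4) * exp (- (r * sin \<theta>)\<^sup>2 / 4) = exp (- r\<^sup>2 / 4)"
        unfolding exp_add[symmetric] sq[symmetric] by (simp add: field_simps)
      then have "2 * normal_density 0 (sqrt 2) (r * cos \<theta>) * normal_density 0 (sqrt 2) (r * sin \<theta>) * r =
          1 / (2 * pi) * r * exp (- r\<^sup>2 / 4)"
        unfolding normal_density_sqrt_2 by (simp add: field_simps)
      moreover have "2 * n (r * cos \<theta>) * n (r * sin \<theta>) * ennreal r =
          ennreal (2 * normal_density 0 (sqrt 2) (r * cos \<theta>) * normal_density 0 (sqrt 2) (r * sin \<theta>) * r)"
        using True by (simp add: n_def ennreal_mult)
      moreover have "F (r * cos \<theta>, r * sin \<theta>) * ennreal r =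
          h (r * cos \<theta>) * (2 * n (r * cos \<theta>) * n (r * sin \<theta>) * ennreal r)"
        by (simp only: F_def prod.case mult_ac)
      ultimately show ?thesis
        by simp
    qed simp
  qed
  finally show ?thesis .
qed

section \<open>The maximum of an exchangeable Gaussian triple\<close>

lemma gaussian_vector_permute:
  fixes X :: "'a \<Rightarrow> real ^ 'n"
  assumes X: "gaussian_vector M X (equicov a b)" and p: "bij p"
  shows "gaussian_vector M (\<lambda>\<omega>. \<chi> i. X \<omega> $ p i) (equicov a b)"
proof -
  note [measurable] = gaussian_vectorD(1)[OF X]
  have "(\<lambda>\<omega>. \<chi> i. X \<omega> $ p i) \<in> borel_measurable M"
    by (rule borel_measurable_vec_lambda) measurable
  moreover have "0 \<le> t \<bullet> (equicov a b *v t) \<and>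
      distr M borel (\<lambda>\<omega>. t \<bullet> (\<chi> i. X \<omega> $ p i)) = normal_measure 0 (t \<bullet> (equicov a b *v t))" for t
  proof -
    define s where "s = (\<chi> i. t $ inv p i)"
    have reindex: "(\<Sum>i\<in>UNIV. g (s $ i) i) = (\<Sum>i\<in>UNIV. g (t $ i) (p i))"
      for g :: "real \<Rightarrow> 'n \<Rightarrow> real"
      using sum.reindex_bij_betw[OF p, of "\<lambda>i. g (s $ i) i"] p
      by (simp add: s_def bij_is_inj)
    have "t \<bullet> (\<chi> i. x $ p i) = s \<bullet> x" for x
      unfolding inner_vec_def using reindex[of "\<lambda>u i. u * x $ i"] by simp
    moreover have "t \<bullet> (equicov a b *v t) = s \<bullet> (equicov a b *v s)"
      unfolding inner_equicov using reindex[of "\<lambda>u i. u\<^sup>2"] reindex[of "\<lambda>u i. u"] by simp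
    ultimately show ?thesis
      using gaussian_vectorD(2,3)[OF X, of s] by (simp only: simp_thms)
  qed
  ultimately show ?thesis unfolding gaussian_vector_def by blast
qed

text \<open>
  The difference of two coordinates is normal with variance \<open>2 * (a - b) > 0\<close>, hence has no
  atom at \<open>0\<close>.
\<close>

lemma gaussian_vector_no_ties:
  fixes X :: "'a \<Rightarrow> real ^ 'n"
  assumes X: "gaussian_vector M X (equicov a b)" and "b < a" "i \<noteq> j"
  shows "AE \<omega> in M. X \<omega> $ i \<noteq> X \<omega> $ j"
proof -
  note [measurable] = gaussian_vectorD(1)[OF X]
  define t :: "real ^ 'n" where "t = axis i 1 - axis j 1"
  have inner: "t \<bullet> x = x $ i - x $ j" for x
    by (simp add: t_def inner_diff_left inner_commute[of "axis _ _"] inner_axis)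
  have "(\<Sum>k\<in>UNIV. t $ k) = 0" "(\<Sum>k\<in>UNIV. (t $ k)\<^sup>2) = 2"
  proof -
    have "t $ k = (if k = i then 1 else 0) - (if k = j then 1 else 0)" for k
      by (simp add: t_def axis_def)
    moreover have "(t $ k)\<^sup>2 = (if k = i then 1 else 0) + (if k = j then 1 else 0)" for k
      using \<open>i \<noteq> j\<close> by (auto simp: t_def axis_def)
    ultimately show "(\<Sum>k\<in>UNIV. t $ k) = 0" "(\<Sum>k\<in>UNIV. (t $ k)\<^sup>2) = 2"
      by (simp_all add: sum.distrib sum_subtractf)
  qed
  then have v: "t \<bullet> (equicov a b *v t) = 2 * (a - b)"
    unfolding inner_equicov by simp
  have "AE x in normal_measure 0 (2 * (a - b)). x \<noteq> 0"
  proof -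
    \<comment> \<open>The variance is positive, so the law has a density and does not charge \<open>0\<close>.\<close>
    have density: "normal_measure 0 (2 * (a - b)) = density lborel (normal_density 0 (sqrt (2 * (a - b))))"
      using \<open>b < a\<close> by (simp add: normal_measure_def)
    have "AE x in lborel. 0 < ennreal (normal_density 0 (sqrt (2 * (a - b))) x) \<longrightarrow> x \<noteq> 0"
      using AE_lborel_singleton[of "0::real"] by eventually_elim simp
    then show ?thesis
      unfolding density by (subst AE_density) simp_all
  qed
  then have "AE x in distr M borel (\<lambda>\<omega>. t \<bullet> X \<omega>). x \<noteq> 0"
    by (simp only: gaussian_vectorD(3)[OF X] v)
  moreover have "(\<lambda>\<omega>. t \<bullet> X \<omega>) \<in> measurable M borel"
    by measurable
  ultimately have "AE \<omega> in M. t \<bullet> X \<omega> \<noteq> 0"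
    by (simp add: AE_distr_iff)
  then show ?thesis by (simp add: inner)
qed

definition first_wins :: "real ^ 3 \<Rightarrow> bool" where
  "first_wins z \<longleftrightarrow> z $ 2 < z $ 1 \<and> z $ 3 < z $ 1"

lemma borel_measurable_first_wins [measurable]: "Measurable.pred borel first_wins"
  unfolding first_wins_def[abs_def] by measurable

text \<open>
  Up to ties exactly one coordinate is the largest, and by exchangeability each of the three
  cases contributes the same amount.
\<close>

lemma nn_integral_max3_exchangeable:
  fixes h :: "real \<Rightarrow> ennreal"
  assumes M: "prob_space M" and X: "gaussian_vector M X (equicov a b)" and "b < a"
    and [measurable]: "h \<in> borel_measurable borel"
  shows "(\<integral>\<^sup>+\<omega>. h (max3 (X \<omega>)) \<partial>M) =
    3 * (\<integral>\<^sup>+\<omega>. h (X \<omega> $ 1) * indicator (Collect first_wins) (X \<omega>) \<partial>M)"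
proof -
  note Xm [measurable] = gaussian_vectorD(1)[OF X]
  define g where "g z = h (z $ 1) * indicator (Collect first_wins) z" for z :: "real ^ 3"
  have g [measurable]: "g \<in> borel_measurable borel" unfolding g_def by measurable
  \<comment> \<open>The two cyclic shifts bring the second and the third coordinate to the front.\<close>
  define p where "p = (\<lambda>i::3. if i = 1 then 2 else if i = 2 then 3 else 1 :: 3)"
  define q where "q = (\<lambda>i::3. if i = 1 then 3 else if i = 2 then 1 else 2 :: 3)"
  have "p \<circ> q = id" "q \<circ> p = id"
    by (simp_all add: p_def q_def fun_eq_iff forall_3)
  then have bij: "bij p" "bij q" using o_bij by blast+
  have perm: "(\<integral>\<^sup>+\<omega>. g (\<chi> i. X \<omega> $ s i) \<partial>M) = (\<integral>\<^sup>+\<omega>. g (X \<omega>) \<partial>M)" if "bij s" for s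
  proof -
    note Y = gaussian_vector_permute[OF X that]
    have "(\<integral>\<^sup>+\<omega>. g (\<chi> i. X \<omega> $ s i) \<partial>M) = (\<integral>\<^sup>+z. g z \<partial>distr M borel (\<lambda>\<omega>. \<chi> i. X \<omega> $ s i))"
      using gaussian_vectorD(1)[OF Y] by (intro nn_integral_distr[symmetric]) simp_all
    also have "\<dots> = (\<integral>\<^sup>+z. g z \<partial>distr M borel X)"
      by (simp only: gaussian_vector_distr_eq[OF M M Y X])
    also have "\<dots> = (\<integral>\<^sup>+\<omega>. g (X \<omega>) \<partial>M)"
      by (intro nn_integral_distr) simp_all
    finally show ?thesis .
  qed
  have gm: "(\<lambda>\<omega>. g (\<chi> i. X \<omega> $ s i)) \<in> borel_measurable M" for s
    by (rule measurable_compose[OF _ g], rule borel_measurable_vec_lambda) measurable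
  have "(\<integral>\<^sup>+\<omega>. h (max3 (X \<omega>)) \<partial>M) =
      (\<integral>\<^sup>+\<omega>. g (X \<omega>) + (g (\<chi> i. X \<omega> $ p i) + g (\<chi> i. X \<omega> $ q i)) \<partial>M)"
  proof (rule nn_integral_cong_AE)
    have "AE \<omega> in M. X \<omega> $ 1 \<noteq> X \<omega> $ 2" "AE \<omega> in M. X \<omega> $ 2 \<noteq> X \<omega> $ 3" "AE \<omega> in M. X \<omega> $ 1 \<noteq> X \<omega> $ 3"
      by (rule gaussian_vector_no_ties[OF X \<open>b < a\<close>]; simp)+
    then show "AE \<omega> in M. h (max3 (X \<omega>)) =
        g (X \<omega>) + (g (\<chi> i. X \<omega> $ p i) + g (\<chi> i. X \<omega> $ q i))"
    proof eventually_elim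
      case (elim \<omega>)
      then show ?case
        by (auto simp: g_def first_wins_def p_def q_def max3_eq max_def indicator_def)
    qed
  qed
  also have "\<dots> = (\<integral>\<^sup>+\<omega>. g (X \<omega>) \<partial>M) +
      ((\<integral>\<^sup>+\<omega>. g (\<chi> i. X \<omega> $ p i) \<partial>M) + (\<integral>\<^sup>+\<omega>. g (\<chi> i. X \<omega> $ q i) \<partial>M))"
    using gm by (subst nn_integral_add; (subst nn_integral_add)?) auto
  also have "\<dots> = 3 * (\<integral>\<^sup>+\<omega>. g (X \<omega>) \<partial>M)"
  proof -
    have "(3::ennreal) = 1 + (1 + 1)" by simp
    then show ?thesis
      by (simp only: perm[OF bij(1)] perm[OF bij(2)] distrib_right mult_1_left)
  qed
  finally show ?thesis unfolding g_def .
qed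

text \<open>
  The inner products of \<open>(x, y)\<close> with the unit vectors at the angles \<open>0\<close>, \<open>2 * pi / 3\<close> and
  \<open>- 2 * pi / 3\<close>: an explicit model of the degenerate covariance matrix with entries \<open>2\<close> and \<open>-1\<close>.
\<close>

definition planar_triple :: "real \<times> real \<Rightarrow> real ^ 3" where
  "planar_triple = (\<lambda>(x, y). vector [x, - x / 2 + sqrt 3 / 2 * y, - x / 2 - sqrt 3 / 2 * y])"

lemma first_wins_planar_triple:
  "first_wins (planar_triple (x, y)) \<longleftrightarrow> y \<in> {- sqrt 3 * x<..<sqrt 3 * x}"
proof -
  have "sqrt 3 / 2 * y < 3 / 2 * x \<longleftrightarrow> y < sqrt 3 * x" for y
  proof -
    have "3 / 2 * x = sqrt 3 / 2 * (sqrt 3 * x)" by simp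
    then show ?thesis by (simp only: mult_less_cancel_left_pos) simp
  qed
  from this[of y] this[of "- y"] show ?thesis
    by (auto simp: first_wins_def planar_triple_def field_simps)
qed

lemma indep_var_fst_snd:
  assumes A: "prob_space A" and B: "prob_space B"
  shows "prob_space.indep_var (A \<Otimes>\<^sub>M B) A fst B snd"
    and "distr (A \<Otimes>\<^sub>M B) A fst = A" "distr (A \<Otimes>\<^sub>M B) B snd = B"
proof -
  interpret A: prob_space A by fact
  interpret B: prob_space B by fact
  interpret P: prob_space "A \<Otimes>\<^sub>M B" using A B by (rule prob_space_pair)
  show fst: "distr (A \<Otimes>\<^sub>M B) A fst = A" by (rule B.distr_pair_fst)
  show snd: "distr (A \<Otimes>\<^sub>M B) B snd = B"
  proof (rule measure_eqI)
    fix S assume S: "S \<in> sets (distr (A \<Otimes>\<^sub>M B) B snd)"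
    then have "snd -` S \<inter> space (A \<Otimes>\<^sub>M B) = space A \<times> S"
      using sets.sets_into_space[of S B] by (auto simp: space_pair_measure)
    with S show "emeasure (distr (A \<Otimes>\<^sub>M B) B snd) S = emeasure B S"
      by (simp add: emeasure_distr B.emeasure_pair_measure_Times A.emeasure_space_1)
  qed simp
  show "P.indep_var A fst B snd"
    unfolding P.indep_var_distribution_eq fst snd
    by (simp add: distr_id2 cong: distr_cong)
qed

lemma gaussian_vector_planar_triple:
  "gaussian_vector (normal_measure 0 2 \<Otimes>\<^sub>M normal_measure 0 2) planar_triple (equicov 2 (- 1))"
proof -
  let ?N = "normal_measure 0 2"
  have N: "prob_space ?N" by (rule prob_space_normal_measure) simp
  interpret prob_space "?N \<Otimes>\<^sub>M ?N" using N N by (rule prob_space_pair)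
  have "planar_triple = (\<lambda>\<omega>. \<chi> i. if i = 1 then fst \<omega> else if i = 2
      then - fst \<omega> / 2 + sqrt 3 / 2 * snd \<omega> else - fst \<omega> / 2 - sqrt 3 / 2 * snd \<omega>)"
    by (simp add: planar_triple_def fun_eq_iff vec_eq_iff forall_3)
  also have "\<dots> \<in> borel_measurable (?N \<Otimes>\<^sub>M ?N)"
    by (rule borel_measurable_vec_lambda) measurable
  finally have meas: "planar_triple \<in> borel_measurable (?N \<Otimes>\<^sub>M ?N)" .
  have law: "0 \<le> t \<bullet> (equicov 2 (- 1) *v t) \<and>
      distr (?N \<Otimes>\<^sub>M ?N) borel (\<lambda>\<omega>. t \<bullet> planar_triple \<omega>) =
      normal_measure 0 (t \<bullet> (equicov 2 (- 1) *v t))" for t :: "real ^ 3"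
  proof -
    \<comment> \<open>The projection \<open>t \<bullet> planar_triple (x, y)\<close> is \<open>c * x + d * y\<close>.\<close>
    define c d where "c = t $ 1 - t $ 2 / 2 - t $ 3 / 2" and "d = sqrt 3 / 2 * (t $ 2 - t $ 3)"
    have "distr (?N \<Otimes>\<^sub>M ?N) borel (\<lambda>\<omega>. c * fst \<omega> + d * snd \<omega>) =
        normal_measure (c * 0 + d * 0) (c\<^sup>2 * 2 + d\<^sup>2 * 2)"
    proof (rule distr_add_indep_normal)
      show "indep_var borel (\<lambda>\<omega>. c * fst \<omega>) borel (\<lambda>\<omega>. d * snd \<omega>)"
        using indep_var_compose[OF indep_var_fst_snd(1)[OF N N], of "\<lambda>x. c * x" borel "\<lambda>x. d * x" borel]
        by (simp add: comp_def)
      have "distr (?N \<Otimes>\<^sub>M ?N) borel fst = ?N" "distr (?N \<Otimes>\<^sub>M ?N) borel snd = ?N"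
        using indep_var_fst_snd(2,3)[OF N N] by (simp_all cong: distr_cong)
      note marginals = this
      show "distr (?N \<Otimes>\<^sub>M ?N) borel (\<lambda>\<omega>. c * fst \<omega>) = normal_measure (c * 0) (c\<^sup>2 * 2)"
        by (rule distr_cmult_normal[OF _ marginals(1)]) simp_all
      show "distr (?N \<Otimes>\<^sub>M ?N) borel (\<lambda>\<omega>. d * snd \<omega>) = normal_measure (d * 0) (d\<^sup>2 * 2)"
        by (rule distr_cmult_normal[OF _ marginals(2)]) simp_all
    qed simp_all
    moreover have "t \<bullet> planar_triple \<omega> = c * fst \<omega> + d * snd \<omega>" for \<omega>
      by (cases \<omega>) (simp add: planar_triple_def inner_vec_def sum_3 c_def d_def algebra_simps)
    moreover have "t \<bullet> (equicov 2 (- 1) *v t) = c\<^sup>2 * 2 + d\<^sup>2 * 2"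
    proof -
      have "d\<^sup>2 = 3 / 4 * (t $ 2 - t $ 3)\<^sup>2"
        by (simp add: d_def power_mult_distrib power_divide)
      then show ?thesis
        unfolding inner_equicov by (simp add: sum_3 c_def) (simp add: power2_eq_square field_simps)
    qed
    ultimately show ?thesis by simp
  qed
  from meas law show ?thesis unfolding gaussian_vector_def by blast
qed

text \<open>
  The law of the maximum depends only on the covariance matrix, so it may be computed for
  the planar model, where the first coordinate wins on the sector of
  \<open>nn_integral_normal_sector\<close>.
\<close>

lemma nn_integral_max3_polar:
  fixes h :: "real \<Rightarrow> ennreal"
  assumes M: "prob_space M" and X: "gaussian_vector M X (equicov 2 (- 1))"
    and [measurable]: "h \<in> borel_measurable borel"
  shows "(\<integral>\<^sup>+\<omega>. h (max3 (X \<omega>)) \<partial>M) =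
    3 * (\<integral>\<^sup>+\<theta>. \<integral>\<^sup>+r. h (r * cos \<theta>) * ennreal (1 / (2 * pi) * r * exp (- r\<^sup>2 / 4)) *
       indicator {0<..} r * indicator {0..pi/3} \<theta> \<partial>lborel \<partial>lborel)"
proof -
  let ?N = "normal_measure 0 2"
  have N: "prob_space ?N" by (rule prob_space_normal_measure) simp
  interpret N: prob_space ?N by fact
  have P: "prob_space (?N \<Otimes>\<^sub>M ?N)" using N N by (rule prob_space_pair)
  note Z = gaussian_vector_planar_triple
  note [measurable] = gaussian_vectorD(1)[OF X] gaussian_vectorD(1)[OF Z]
  have "(\<integral>\<^sup>+\<omega>. h (max3 (X \<omega>)) \<partial>M) = (\<integral>\<^sup>+u. h u \<partial>distr M borel (\<lambda>\<omega>. max3 (X \<omega>)))"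
    by (rule nn_integral_distr[symmetric]) measurable
  also have "\<dots> = (\<integral>\<^sup>+u. h u \<partial>distr (?N \<Otimes>\<^sub>M ?N) borel (\<lambda>\<omega>. max3 (planar_triple \<omega>)))"
    by (simp only: gaussian_vector_max3_eq[OF M P X Z])
  also have "\<dots> = (\<integral>\<^sup>+\<omega>. h (max3 (planar_triple \<omega>)) \<partial>(?N \<Otimes>\<^sub>M ?N))"
    by (rule nn_integral_distr) measurable
  also have "\<dots> = 3 * (\<integral>\<^sup>+\<omega>. h (planar_triple \<omega> $ 1) *
      indicator (Collect first_wins) (planar_triple \<omega>) \<partial>(?N \<Otimes>\<^sub>M ?N))"
    by (rule nn_integral_max3_exchangeable[OF P Z]) simp_all
  also have "(\<integral>\<^sup>+\<omega>. h (planar_triple \<omega> $ 1) *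
      indicator (Collect first_wins) (planar_triple \<omega>) \<partial>(?N \<Otimes>\<^sub>M ?N)) =
      (\<integral>\<^sup>+x. \<integral>\<^sup>+y. h (planar_triple (x, y) $ 1) *
      indicator (Collect first_wins) (planar_triple (x, y)) \<partial>?N \<partial>?N)"
    by (rule N.nn_integral_fst[symmetric]) measurable
  also have "\<dots> = (\<integral>\<^sup>+x. \<integral>\<^sup>+y. h x * indicator {- sqrt 3 * x<..<sqrt 3 * x} y \<partial>?N \<partial>?N)"
  proof -
    have "planar_triple (x, y) $ 1 = x" for x y
      by (simp add: planar_triple_def)
    then show ?thesis
      by (simp only: indicator_def mem_Collect_eq first_wins_planar_triple)
  qed
  also have "\<dots> = (\<integral>\<^sup>+\<theta>. \<integral>\<^sup>+r. h (r * cos \<theta>) * ennreal (1 / (2 * pi) * r * exp (- r\<^sup>2 / 4)) *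
       indicator {0<..} r * indicator {0..pi/3} \<theta> \<partial>lborel \<partial>lborel)"
    by (rule nn_integral_normal_sector) measurable
  finally show ?thesis .
qed

section \<open>The maximum in polar form\<close>

text \<open>
  The constants match because \<open>3 / (2 * pi) = (1 / 2) / (pi / 3)\<close>; the open and the closed
  interval of angles differ by a null set.
\<close>

lemma (in prob_space) distr_polar_eq_distr_max3:
  assumes ind: "indep_var borel \<Theta> borel R"
    and R: "distributed M lborel R (\<lambda>r. ennreal (if 0 < r then 1/2 * r * exp (- r\<^sup>2 / 4) else 0))"
    and \<Theta>: "distributed M lborel \<Theta> (\<lambda>x. indicator {0<..<pi/3} x / measure lborel {0<..<pi/3})"
    and N: "prob_space N" and X: "gaussian_vector N X (equicov 2 (- 1))"
  shows "distr M borel (\<lambda>\<omega>. R \<omega> * cos (\<Theta> \<omega>)) = distr N borel (\<lambda>\<omega>. max3 (X \<omega>))"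
proof (rule measure_eqI)
  note [measurable] = indep_var_rv1[OF ind] indep_var_rv2[OF ind] gaussian_vectorD(1)[OF X]
  define dR where "dR r = ennreal (if 0 < r then 1/2 * r * exp (- r\<^sup>2 / 4) else 0)" for r
  define d\<Theta> where "d\<Theta> \<theta> = ennreal (indicator {0<..<pi/3} \<theta> / measure lborel {0<..<pi/3})" for \<theta>
  have [measurable]: "dR \<in> borel_measurable borel" "d\<Theta> \<in> borel_measurable borel"
    unfolding dR_def d\<Theta>_def by measurable
  have lawR: "distr M borel R = density lborel dR"
    using distributed_distr_eq_density[OF R] by (simp add: dR_def[abs_def] cong: distr_cong)
  have law\<Theta>: "distr M borel \<Theta> = density lborel d\<Theta>"
    using distributed_distr_eq_density[OF \<Theta>] by (simp add: d\<Theta>_def[abs_def] cong: distr_cong)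
  interpret R: prob_space "distr M borel R" by (rule prob_space_distr) simp
  fix A assume "A \<in> sets (distr M borel (\<lambda>\<omega>. R \<omega> * cos (\<Theta> \<omega>)))"
  then have A [measurable]: "A \<in> sets borel" by simp
  define h :: "real \<Rightarrow> ennreal" where "h = indicator A"
  have h [measurable]: "h \<in> borel_measurable borel" unfolding h_def by simp
  define G where "G \<theta> r = h (r * cos \<theta>) * ennreal (1 / (2 * pi) * r * exp (- r\<^sup>2 / 4)) *
       indicator {0<..} r * indicator {0..pi/3} \<theta>" for \<theta> r
  have G [measurable]: "case_prod G \<in> borel_measurable (borel \<Otimes>\<^sub>M borel)"
    unfolding G_def by measurable
  have "emeasure (distr M borel (\<lambda>\<omega>. R \<omega> * cos (\<Theta> \<omega>))) A = (\<integral>\<^sup>+u. h u \<partial>distr M borel (\<lambda>\<omega>. R \<omega> * cos (\<Theta> \<omega>)))"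
    unfolding h_def by simp
  also have "\<dots> = (\<integral>\<^sup>+\<omega>. h (R \<omega> * cos (\<Theta> \<omega>)) \<partial>M)"
    by (rule nn_integral_distr) measurable
  also have "\<dots> = (\<integral>\<^sup>+p. h (snd p * cos (fst p)) \<partial>distr M (borel \<Otimes>\<^sub>M borel) (\<lambda>\<omega>. (\<Theta> \<omega>, R \<omega>)))"
    by (subst nn_integral_distr) simp_all
  also have "\<dots> = (\<integral>\<^sup>+p. h (snd p * cos (fst p)) \<partial>(distr M borel \<Theta> \<Otimes>\<^sub>M distr M borel R))"
    using ind by (simp add: indep_var_distribution_eq)
  also have "\<dots> = (\<integral>\<^sup>+\<theta>. \<integral>\<^sup>+r. h (r * cos \<theta>) \<partial>distr M borel R \<partial>distr M borel \<Theta>)"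
    by (subst R.nn_integral_fst[symmetric]) simp_all
  also have "\<dots> = (\<integral>\<^sup>+\<theta>. d\<Theta> \<theta> * (\<integral>\<^sup>+r. dR r * h (r * cos \<theta>) \<partial>lborel) \<partial>lborel)"
  proof -
    have "(\<integral>\<^sup>+r. h (r * cos \<theta>) \<partial>density lborel dR) = (\<integral>\<^sup>+r. dR r * h (r * cos \<theta>) \<partial>lborel)" for \<theta>
      by (rule nn_integral_density) measurable
    then show ?thesis
      unfolding lawR law\<Theta> by (simp only:) (rule nn_integral_density; measurable)
  qed
  also have "\<dots> = (\<integral>\<^sup>+\<theta>. 3 * (\<integral>\<^sup>+r. G \<theta> r \<partial>lborel) \<partial>lborel)"
  proof (rule nn_integral_cong_AE)
    have "AE \<theta> in lborel. \<theta> \<noteq> 0 \<and> \<theta> \<noteq> pi/3"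
      using AE_lborel_singleton[of 0] AE_lborel_singleton[of "pi/3"] by eventually_elim auto
    then show "AE \<theta> in lborel. d\<Theta> \<theta> * (\<integral>\<^sup>+r. dR r * h (r * cos \<theta>) \<partial>lborel) = 3 * (\<integral>\<^sup>+r. G \<theta> r \<partial>lborel)"
    proof eventually_elim
      case (elim \<theta>)
      have "d\<Theta> \<theta> * (\<integral>\<^sup>+r. dR r * h (r * cos \<theta>) \<partial>lborel) =
          (\<integral>\<^sup>+r. d\<Theta> \<theta> * (dR r * h (r * cos \<theta>)) \<partial>lborel)"
        by (rule nn_integral_cmult[symmetric]) measurable
      also have "\<dots> = (\<integral>\<^sup>+r. 3 * G \<theta> r \<partial>lborel)"
      proof (rule nn_integral_cong)
        fix r
        show "d\<Theta> \<theta> * (dR r * h (r * cos \<theta>)) = 3 * G \<theta> r"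
        proof (cases "0 < r \<and> \<theta> \<in> {0<..<pi/3}")
          case True
          have "3 * ennreal (1 / (2 * pi) * r * exp (- r\<^sup>2 / 4)) =
              ennreal (3 * (1 / (2 * pi) * r * exp (- r\<^sup>2 / 4)))"
            using True by (subst ennreal_mult) simp_all
          also have "3 * (1 / (2 * pi) * r * exp (- r\<^sup>2 / 4)) = (3 / pi) * (1/2 * r * exp (- r\<^sup>2 / 4))"
            by (simp add: field_simps)
          also have "ennreal \<dots> = d\<Theta> \<theta> * dR r"
            using True by (subst ennreal_mult) (simp_all add: d\<Theta>_def dR_def)
          finally have eq: "d\<Theta> \<theta> * dR r = 3 * ennreal (1 / (2 * pi) * r * exp (- r\<^sup>2 / 4))" ..
          have "G \<theta> r = h (r * cos \<theta>) * ennreal (1 / (2 * pi) * r * exp (- r\<^sup>2 / 4))"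
            using True by (simp add: G_def)
          then have "3 * G \<theta> r = (3 * ennreal (1 / (2 * pi) * r * exp (- r\<^sup>2 / 4))) * h (r * cos \<theta>)"
            by (simp only: mult_ac)
          also have "\<dots> = d\<Theta> \<theta> * (dR r * h (r * cos \<theta>))"
            unfolding eq[symmetric] by (rule mult.assoc)
          finally show ?thesis ..
        next
          case False
          then have "d\<Theta> \<theta> * dR r = 0" "G \<theta> r = 0"
            using elim by (auto simp: d\<Theta>_def dR_def G_def indicator_def)
          then show ?thesis by (simp flip: mult.assoc)
        qed
      qed
      also have "\<dots> = 3 * (\<integral>\<^sup>+r. G \<theta> r \<partial>lborel)"
        by (rule nn_integral_cmult) measurable
      finally show ?case .
    qed
  qed
  also have "\<dots> = 3 * (\<integral>\<^sup>+\<theta>. \<integral>\<^sup>+r. G \<theta> r \<partial>lborel \<partial>lborel)"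
    by (rule nn_integral_cmult) measurable
  also have "\<dots> = (\<integral>\<^sup>+\<omega>. h (max3 (X \<omega>)) \<partial>N)"
    unfolding G_def by (rule nn_integral_max3_polar[OF N X h, symmetric])
  also have "\<dots> = (\<integral>\<^sup>+u. h u \<partial>distr N borel (\<lambda>\<omega>. max3 (X \<omega>)))"
    by (rule nn_integral_distr[symmetric]) measurable
  also have "\<dots> = emeasure (distr N borel (\<lambda>\<omega>. max3 (X \<omega>))) A"
    unfolding h_def by simp
  finally show "emeasure (distr M borel (\<lambda>\<omega>. R \<omega> * cos (\<Theta> \<omega>))) A =
      emeasure (distr N borel (\<lambda>\<omega>. max3 (X \<omega>))) A" .
qed simp

lemma (in prob_space) indep_vars_triple:
  assumes "indep_vars (\<lambda>_. borel) (\<lambda>i. [X, Y, Z] ! i) {..<3}"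
    and [measurable]: "case_prod g \<in> borel_measurable (borel \<Otimes>\<^sub>M borel)"
  shows "indep_var borel Z borel Y" "indep_var borel X borel (\<lambda>\<omega>. g (Y \<omega>) (Z \<omega>) :: real)"
proof -
  let ?f = "\<lambda>i. [X, Y, Z] ! i"
  have r: "indep_var borel (\<lambda>\<omega>. u (restrict (\<lambda>i. ?f i \<omega>) A)) borel (\<lambda>\<omega>. v (restrict (\<lambda>i. ?f i \<omega>) B))"
    if "A \<inter> B = {}" "A \<subseteq> {..<3}" "B \<subseteq> {..<3}"
      and "u \<in> borel_measurable (Pi\<^sub>M A (\<lambda>_. borel))" "v \<in> borel_measurable (Pi\<^sub>M B (\<lambda>_. borel))"
    for u v :: "(nat \<Rightarrow> real) \<Rightarrow> real" and A B
    using indep_var_compose[OF indep_var_restrict[OF assms(1) that(1-3)] that(4,5)]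
    by (simp add: comp_def)
  show "indep_var borel Z borel Y"
    using r[of "{2}" "{1}" "\<lambda>x. x 2" "\<lambda>x. x 1"] by simp
  show "indep_var borel X borel (\<lambda>\<omega>. g (Y \<omega>) (Z \<omega>))"
    using r[of "{0}" "{1, 2}" "\<lambda>x. x 0" "\<lambda>x. g (x 1) (x 2)"] by simp
qed

section \<open>The equivalent descriptions of the score\<close>

theorem theorem4p1:
  fixes M :: "'a measure" and W0 :: "'a \<Rightarrow> real" and V :: "'a \<Rightarrow> real ^ 3" and S :: "'a \<Rightarrow> real"
  assumes "prob_space M"
    and "jointly_normal M (\<lambda>\<omega>. (W0 \<omega>, V \<omega>))"
    and "prob_space.indep_rvs M borel W0 borel V"
    and "distributed M lborel W0 (normal_density 0 (sqrt 2))"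
    and "mv_normal M V 0
           (vector [vector [ 2/3, -1/3, -1/3],
                    vector [-1/3,  2/3, -1/3],
                    vector [-1/3, -1/3,  2/3]])"
    and S: "S = (\<lambda>\<omega>. W0 \<omega> +
           Max {V \<omega> $ 1 + 2 * V \<omega> $ 2, V \<omega> $ 2 + 2 * V \<omega> $ 3, V \<omega> $ 3 + 2 * V \<omega> $ 1})"
  shows
    "(\<forall>(N :: 'b measure) (W :: 'b \<Rightarrow> real) (Z :: 'b \<Rightarrow> real ^ 3).
        prob_space N \<and>
        jointly_normal N (\<lambda>\<omega>. (W \<omega>, Z \<omega>)) \<and>
        prob_space.indep_rvs N borel W borel Z \<and>
        distributed N lborel W (normal_density 0 (sqrt 2)) \<and>
        mv_normal N Z 0
          (vector [vector [ 2, -1, -1],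
                   vector [-1,  2, -1],
                   vector [-1, -1,  2]]) \<longrightarrow>
        distr M borel S =
        distr N borel (\<lambda>\<omega>. W \<omega> + Max {Z \<omega> $ 1, Z \<omega> $ 2, Z \<omega> $ 3})) \<and>
     (\<forall>(N :: 'c measure) (W' :: 'c \<Rightarrow> real) (Z1' :: 'c \<Rightarrow> real) (Z2' :: 'c \<Rightarrow> real)
        (Z3' :: 'c \<Rightarrow> real).
        prob_space N \<and>
        prob_space.indep_vars N (\<lambda>_. borel) (\<lambda>i. [W', Z1', Z2', Z3'] ! i) {..<4} \<and>
        distributed N lborel W' std_normal_density \<and>
        distributed N lborel Z1' std_normal_density \<and>
        distributed N lborel Z2' std_normal_density \<and>
        distributed N lborel Z3' std_normal_density \<longrightarrow>
        distr M borel S =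
        distr N borel (\<lambda>\<omega>. W' \<omega> + sqrt 3 * Max {Z1' \<omega>, Z2' \<omega>, Z3' \<omega>})) \<and>
     (\<forall>(N :: 'd measure) (Z'' :: 'd \<Rightarrow> real ^ 3).
        prob_space N \<and>
        mv_normal N Z'' 0
          (vector [vector [4, 1, 1],
                   vector [1, 4, 1],
                   vector [1, 1, 4]]) \<longrightarrow>
        distr M borel S =
        distr N borel (\<lambda>\<omega>. Max {Z'' \<omega> $ 1, Z'' \<omega> $ 2, Z'' \<omega> $ 3})) \<and>
     (\<forall>(N :: 'e measure) (W :: 'e \<Rightarrow> real) (R :: 'e \<Rightarrow> real) (\<Theta> :: 'e \<Rightarrow> real).
        prob_space N \<and>
        prob_space.indep_vars N (\<lambda>_. borel) (\<lambda>i. [W, R, \<Theta>] ! i) {..<3} \<and>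
        distributed N lborel W (normal_density 0 (sqrt 2)) \<and>
        distributed N lborel R (\<lambda>r. if 0 < r then 1/2 * r * exp (- r\<^sup>2 / 4) else 0) \<and>
        distributed N lborel \<Theta>
          (\<lambda>x. indicator {0<..<pi/3} x / measure lborel {0<..<pi/3}) \<longrightarrow>
        distr M borel S = distr N borel (\<lambda>\<omega>. W \<omega> + R \<omega> * cos (\<Theta> \<omega>)))"
proof -
  interpret M: prob_space M by fact
  let ?Q = "equicov 4 1 :: real ^ 3 ^ 3"
  let ?P = "equicov 2 (- 1) :: real ^ 3 ^ 3"
  \<comment> \<open>The matrix that takes \<open>V\<close> to the three linear forms in the definition of \<open>S\<close>.\<close>
  define B :: "real ^ 3 ^ 3" where "B = vector [vector [1, 2, 0], vector [0, 1, 2], vector [2, 0, 1]]"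
  define U where "U \<omega> = B *v V \<omega>" for \<omega>
  have W0: "distr M borel W0 = normal_measure 0 2"
    using assms(4) by (rule distr_eq_normal_measure) simp
  have V: "gaussian_vector M V (equicov (2/3) (-1/3))"
    using mv_normal_imp_gaussian_vector[OF assms(1,5)] by (simp only: equicov_3)
  have "B ** equicov (2/3) (-1/3) ** transpose B = ?P"
    by (simp add: B_def equicov_3 vec_eq_iff forall_3 matrix_matrix_mult_def transpose_def sum_3)
  then have U: "gaussian_vector M U ?P"
    using gaussian_vector_linear_image[OF V, of B] unfolding U_def by simp
  have indU: "M.indep_rvs borel W0 borel U"
    using M.indep_rvs_compose[OF assms(3), of "\<lambda>w. w" borel "\<lambda>v. B *v v" borel] unfolding U_def
    by (simp add: borel_measurable_continuous_onI matrix_vector_mult_linear_continuous_on)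
  have S_eq: "S = (\<lambda>\<omega>. W0 \<omega> + max3 (U \<omega>))"
    by (simp add: S fun_eq_iff U_def B_def max3_def matrix_vector_mult_def sum_3 add.commute)
  have T: "gaussian_vector M (\<lambda>\<omega>. \<chi> i. W0 \<omega> + U \<omega> $ i) ?Q"
    using M.gaussian_vector_add_common[OF U indU W0] by simp
  have S_law: "distr M borel S = distr N borel (\<lambda>\<omega>. max3 (X \<omega>))"
    if "prob_space N" "gaussian_vector N X ?Q" for N :: "'n measure" and X
    using gaussian_vector_max3_eq[OF assms(1) that(1) T that(2)] by (simp only: S_eq max3_add)
  show ?thesis
  proof (intro conjI allI impI; elim conjE)
    fix N :: "'b measure" and W :: "'b \<Rightarrow> real" and Z :: "'b \<Rightarrow> real ^ 3"
    assume N: "prob_space N" and ind: "prob_space.indep_rvs N borel W borel Z"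
      and W: "distributed N lborel W (normal_density 0 (sqrt 2))"
      and Z: "mv_normal N Z 0
          (vector [vector [ 2, -1, -1],
                   vector [-1,  2, -1],
                   vector [-1, -1,  2]])"
    interpret N: prob_space N by fact
    have "gaussian_vector N Z ?P"
      using mv_normal_imp_gaussian_vector[OF N Z] by (simp only: equicov_3)
    moreover have "distr N borel W = normal_measure 0 2"
      using W by (rule distr_eq_normal_measure) simp
    ultimately have "gaussian_vector N (\<lambda>\<omega>. \<chi> i. W \<omega> + Z \<omega> $ i) ?Q"
      using N.gaussian_vector_add_common[OF _ ind, of 2 "- 1" 2] by simp
    from S_law[OF N this]
    show "distr M borel S = distr N borel (\<lambda>\<omega>. W \<omega> + Max {Z \<omega> $ 1, Z \<omega> $ 2, Z \<omega> $ 3})"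
      by (simp only: max3_add) (simp only: max3_def)
  next
    fix N :: "'c measure" and W' Z1' Z2' Z3' :: "'c \<Rightarrow> real"
    assume N: "prob_space N"
      and ind: "prob_space.indep_vars N (\<lambda>_. borel) (\<lambda>i. [W', Z1', Z2', Z3'] ! i) {..<4}"
      and dist: "distributed N lborel W' std_normal_density"
        "distributed N lborel Z1' std_normal_density"
        "distributed N lborel Z2' std_normal_density"
        "distributed N lborel Z3' std_normal_density"
    have "max3 (vector [w + sqrt 3 * x, w + sqrt 3 * y, w + sqrt 3 * z]) = w + sqrt 3 * Max {x, y, z}"
      for w x y z
      by (simp add: max3_eq max_def)
    then show "distr M borel S = distr N borel (\<lambda>\<omega>. W' \<omega> + sqrt 3 * Max {Z1' \<omega>, Z2' \<omega>, Z3' \<omega>})"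
      using S_law[OF N prob_space.gaussian_vector_indep_std[OF N ind dist]] by (simp only:)
  next
    fix N :: "'d measure" and Z'' :: "'d \<Rightarrow> real ^ 3"
    assume N: "prob_space N"
      and Z: "mv_normal N Z'' 0
          (vector [vector [4, 1, 1],
                   vector [1, 4, 1],
                   vector [1, 1, 4]])"
    have "gaussian_vector N Z'' ?Q"
      using mv_normal_imp_gaussian_vector[OF N Z] by (simp only: equicov_3)
    from S_law[OF N this]
    show "distr M borel S = distr N borel (\<lambda>\<omega>. Max {Z'' \<omega> $ 1, Z'' \<omega> $ 2, Z'' \<omega> $ 3})"
      by (simp only: max3_def)
  next
    fix N :: "'e measure" and W R \<Theta> :: "'e \<Rightarrow> real"
    assume N: "prob_space N"
      and ind: "prob_space.indep_vars N (\<lambda>_. borel) (\<lambda>i. [W, R, \<Theta>] ! i) {..<3}"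
      and W: "distributed N lborel W (normal_density 0 (sqrt 2))"
      and R: "distributed N lborel R (\<lambda>r. if 0 < r then 1/2 * r * exp (- r\<^sup>2 / 4) else 0)"
      and \<Theta>: "distributed N lborel \<Theta>
          (\<lambda>x. indicator {0<..<pi/3} x / measure lborel {0<..<pi/3})"
    interpret N: prob_space N by fact
    have g: "(\<lambda>(r, \<theta>). r * cos \<theta>) \<in> borel_measurable (borel \<Otimes>\<^sub>M (borel :: real measure))"
      by measurable
    note ind' = N.indep_vars_triple[OF ind g]
    show "distr M borel S = distr N borel (\<lambda>\<omega>. W \<omega> + R \<omega> * cos (\<Theta> \<omega>))"
      unfolding S_eq
    proof (rule M.distr_add_indep_cong[OF N _ ind'(2)])
      show "M.indep_var borel W0 borel (\<lambda>\<omega>. max3 (U \<omega>))"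
        by (intro M.indep_rvs_imp_indep_var M.indep_rvs_compose[OF indU]) measurable
      show "distr M borel W0 = distr N borel W"
        using distr_eq_normal_measure[OF W] by (simp add: W0)
      show "distr M borel (\<lambda>\<omega>. max3 (U \<omega>)) = distr N borel (\<lambda>\<omega>. R \<omega> * cos (\<Theta> \<omega>))"
        by (rule N.distr_polar_eq_distr_max3[OF ind'(1) R \<Theta> assms(1) U, symmetric])
    qed
  qed
qed

end
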